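(* Let $h>0$, let $f\in\mathcal{C}_h^\omega(\mathbb{T};\mathbb{R})$ with $f\not\equiv 0$, and let $\alpha$ be irrational. For every $\rho$ with $0<\rho<\frac12\min(h,1)$ there exist $\lambda_0=\lambda_0(f,\rho)>0$, $N=N(f,\rho)\in\mathbb{N}$ and $C=C(f,\rho)>0$ such that for all $\lambda\in\mathbb{R}$ with $|\lambda|>\lambda_0$ and all $E\in\mathbb{R}$, $$L(\alpha,A_{\lambda,E})=\log|\lambda|+\int_{\mathbb{T}}\log\left|\frac{E}{\lambda}-f(x)\right|\,dx+O\!\left(|\lambda|^{-\frac{2}{2N+1}}\right),$$ where $\left|O\!\left(|\lambda|^{-\frac{2}{2N+1}}\right)\right|\le C\,|\lambda|^{-\frac{2}{2N+1}}$.
   Context: $\mathbb{T}=\mathbb{R}/\mathbb{Z}$ with Lebesgue measure $dx$, and $\mathbb{T}_h=\{x+iy : x\in\mathbb{T},\ |y|\le h\}$. $\mathcal{C}_h^\omega(\mathbb{T};\mathbb{R})$ denotes the set of one-periodic real-analytic functions $f:\mathbb{T}\to\mathbb{R}$ that extend analytically to a neighborhood of $\mathbb{T}_h$. For $\lambda,E\in\mathbb{R}$ the Schrödinger cocycle (associated with the quasi-periodic Schrödinger operator $(H_{\lambda;x}\psi)_n=\psi_{n-1}+\psi_{n+1}+\lambda f(x+n\alpha)\psi_n$) is given by $$A_{\lambda,E}(x)=\begin{pmatrix}E-\lambda f(x)&-1\\1&0\end{pmatrix},\qquad A^{(n)}_{\lambda,E}(x;\alpha)=A_{\lambda,E}(x+(n-1)\alpha)\cdots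 A_{\lambda,E}(x),$$ and its Lyapunov exponent is $$L(\alpha,A_{\lambda,E})=\lim_{n\to\infty}\frac1n\int_{\mathbb{T}}\log\|A^{(n)}_{\lambda,E}(x;\alpha)\|\,dx .$$ $\log$ is the natural logarithm. The notation $\lambda_0(f,\rho)$, $N(f,\rho)$, $C(f,\rho)$ indicates that these quantities depend on $f$ and $\rho$.
   Formalization: Here f is assumed nonconstant, not merely f≢0: for any constant f=c≠0 the claim fails, since at E=λc+1/2 the cocycle is a constant elliptic matrix with L=0, while the main term equals −log 2 for every λ. *)

theory Defs
  imports "HOL-Analysis.Analysis"
begin

text \<open>
  A function on the circle \<open>\<real>/\<int>\<close> is a function on \<open>\<real>\<close> of period 1, and its integral over the circle
  is the Lebesgue integral over \<open>{0..1}\<close>. The strip below is the preimage in the complex plane of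
  the closed strip of half-width \<open>h\<close> about the circle.
\<close>

definition strip :: "real \<Rightarrow> complex set"
  where "strip h = {z. \<bar>Im z\<bar> \<le> h}"

text \<open>
  \<open>F analytic_on S\<close> says that \<open>F\<close> is holomorphic on some open set containing \<open>S\<close>
  (\<open>analytic_on_holomorphic\<close>), and periodicity of \<open>F\<close> lets it descend to the quotient by \<open>\<int>\<close>.
\<close>

definition analytic_circle_functions :: "real \<Rightarrow> (real \<Rightarrow> real) set"
  where "analytic_circle_functions h =
    {f. (\<forall>x. f (x + 1) = f x) \<and>
        (\<exists>F. F analytic_on strip h \<and>
             (\<forall>z\<in>strip h. F (z + 1) = F z) \<and>
             (\<forall>x. F (complex_of_real x) = complex_of_real (f x)))}"

definition schroedinger_matrix :: "(real \<Rightarrow> real) \<Rightarrow> real \<Rightarrow> real \<Rightarrow> real \<Rightarrow> real^2^2"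
  where "schroedinger_matrix f lam E x = vector [vector [E - lam * f x, -1], vector [1, 0]]"

text \<open>The \<open>n\<close>-step product \<open>A (x + (n - 1) * \<alpha>) ** \<dots> ** A x\<close>.\<close>

fun cocycle_iterate :: "real \<Rightarrow> (real \<Rightarrow> real^2^2) \<Rightarrow> nat \<Rightarrow> real \<Rightarrow> real^2^2"
  where
    "cocycle_iterate \<alpha> A 0 x = mat 1"
  | "cocycle_iterate \<alpha> A (Suc n) x = A (x + real n * \<alpha>) ** cocycle_iterate \<alpha> A n x"

text \<open>
  The matrix norm is the Euclidean operator norm; the type class \<open>norm\<close> on \<open>real^2^2\<close> would be
  the Frobenius norm.
\<close>

definition lyapunov_exponent :: "real \<Rightarrow> (real \<Rightarrow> real^2^2) \<Rightarrow> real"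
  where "lyapunov_exponent \<alpha> A =
    lim (\<lambda>n. 1 / real n *
      (LINT x:{0..1}|lborel. ln (onorm ((*v) (cocycle_iterate \<alpha> A n x)))))"

end

theory Submission
  imports Defs "HOL-Complex_Analysis.Conformal_Mappings"
    "HOL-Computational_Algebra.Fundamental_Theorem_Algebra"
begin

text \<open>
  Put \<open>e = E / lam\<close>. The sets where \<open>e - f\<close> is small are, uniformly in \<open>e\<close>, covered by boundedly many
  sets of small diameter, in the complex domain as well. Hence a negative power of \<open>\<bar>e - f\<bar>\<close> is integrable
  uniformly in \<open>e\<close>, and close to the real line there are horizontal lines on which \<open>\<bar>e - f\<bar>\<close> is not small.

  The upper bound follows from \<open>\<parallel>A\<parallel> \<le> \<bar>E - lam f\<bar> + 1\<close> and subadditivity. For the lower bound let \<open>P\<^sub>n\<close> be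
  the extension of the upper left entry of the \<open>n\<close>-step matrix. On a good line the three-term
  recursion gives \<open>ln \<bar>P\<^sub>n\<bar> = \<Sum> ln \<bar>E - lam f\<bar> + O(n / D)\<close> with \<open>D\<close> large. The mean of
  \<open>ln (\<bar>P\<^sub>n\<bar>\<^sup>2 + 1) / 2\<close> over horizontal lines is convex in the height, so its values on two good lines
  bound its value on the real line from below, and there it is at most \<open>ln \<parallel>A\<^sub>n\<parallel>\<close> up to a constant.
  All losses are powers of \<open>1 / \<bar>lam\<bar>\<close>, and \<open>N\<close> is chosen large enough to absorb them.
\<close>

section \<open>Sublevel sets of holomorphic functions\<close>

text \<open>The energy is unrestricted, so \<open>e\<close> may lie anywhere inside or outside the
  range of \<open>f\<close>, and no compactness in \<open>e\<close> is available. Uniformity comes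
  from \<open>f\<close> alone: since \<open>f\<close> is not constant, \<open>f - f \<xi>\<close>
  vanishes to finite order at each \<open>\<xi>\<close>, and changing \<open>e\<close> only moves
  the roots of the local model \<open>\<psi> ^ m\<close>.

  On the real line \<open>e - f\<close> may vanish, so the recursion controls nothing there. Two
  lines above it are used because a convex mean M satisfies M(y1) \<le> (1 - t) M(0) + t M(y2) for 0
  < y1 < y2, which can be solved for M(0). The heights must shrink as \<open>lam\<close> grows,
  since the mean at y2 has to stay close to the mean on the real line.

  This fixes the exponents. At heights of order \<sigma> a good line only guarantees that
  \<open>e - f\<close> is at least of order \<sigma>^n, so D is of order |lam| \<sigma>^n, and
  moving the line costs an error of order \<sigma>^p with p = 1/(2n). The choice \<sigma> =
  |lam|^(-p) makes D of order |lam|^(1/2) and the error of order |lam|^(-p^2), whence the exponent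
  1/(4n^2) and N = 4n^2.\<close>

lemma power_minus_factorization:
  fixes w :: complex
  assumes "m > 0"
  obtains B where "size B = m" "\<And>u. u ^ m - w = (\<Prod>b\<in>#B. u - b)"
proof -
  define p where "p = monom 1 m - [:w:]"
  have deg: "degree p = m"
    unfolding p_def diff_conv_add_uminus using assms
    by (subst degree_add_eq_left) (auto simp: degree_monom_eq)
  have lead: "lead_coeff p = 1"
    unfolding deg using assms by (auto simp: p_def coeff_pCons split: nat.split)
  have "p \<noteq> 0" using deg assms by auto
  then obtain B where B: "size B = m" "p = (\<Prod>x\<in>#B. [:-x, 1:])"
    using alg_closed_imp_factorization[of p] deg lead by auto
  have "u ^ m - w = (\<Prod>b\<in>#B. u - b)" for u
  proof -
    have "poly (\<Prod>x\<in>#D. [:-x, 1:]) u = (\<Prod>b\<in>#D. u - b)" for D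
      by (induction D) (auto simp: algebra_simps)
    then have "poly p u = (\<Prod>b\<in>#B. u - b)" using B by simp
    then show ?thesis by (simp add: p_def poly_monom)
  qed
  with B(1) that show ?thesis by blast
qed

text \<open>Applied in contrapositive form: a product of m linear factors that is smaller than
  \<open>c ^ m\<close> has a root within distance \<open>c\<close> of \<open>u\<close>.\<close>

lemma norm_prod_mset_ge_power:
  fixes u :: complex
  assumes "c \<ge> 0" "\<And>b. b \<in># B \<Longrightarrow> c \<le> cmod (u - b)"
  shows "c ^ size B \<le> cmod (\<Prod>b\<in>#B. u - b)"
  using assms by (induction B) (auto simp: norm_mult intro!: mult_mono)

text \<open>Arbitrary sets with a diameter bound are allowed instead of balls or intervals, so that
  covers pass to subsets and to images under maps that do not increase distances, such as real and
  imaginary part.\<close>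

definition diameter_cover :: "nat \<Rightarrow> real \<Rightarrow> 'a::metric_space set \<Rightarrow> bool" where
  "diameter_cover n d S \<longleftrightarrow>
    (\<exists>T. finite T \<and> card T \<le> n \<and> S \<subseteq> \<Union>T \<and> (\<forall>t\<in>T. \<forall>z\<in>t. \<forall>w\<in>t. dist z w \<le> d))"

text \<open>
  Near \<open>\<xi>\<close> one has \<open>f - f \<xi> = \<psi> ^ m\<close> with \<open>\<psi>\<close> bi-Lipschitz, and \<open>\<psi> ^ m - (e - f \<xi>)\<close> splits into \<open>m\<close>
  linear factors in \<open>\<psi>\<close>, one of which is small wherever \<open>e - f\<close> is. This makes the bound uniform in \<open>e\<close>.
\<close>

lemma local_sublevel_cover:
  assumes holf: "f holomorphic_on S" and S: "open S" "connected S" "\<xi> \<in> S"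
    and nonconst: "\<not> f constant_on S"
  obtains r m C where "r > 0" "m > 0" "C > 0"
    "\<And>e \<delta>. \<delta> > 0 \<Longrightarrow> diameter_cover m (C * \<delta> powr (1 / real m)) {z \<in> ball \<xi> r. cmod (e - f z) < \<delta>}"
proof -
  \<comment> \<open>The order to which \<open>f - f \<xi>\<close> vanishes at \<open>\<xi>\<close>;
    it is finite because otherwise \<open>f\<close> would be constant on the connected set
    \<open>S\<close>.\<close>
  define n where "n = (LEAST n. 0 < n \<and> (deriv ^^ n) f \<xi> \<noteq> 0)"
  have "\<exists>n. 0 < n \<and> (deriv ^^ n) f \<xi> \<noteq> 0"
    using holomorphic_fun_eq_const_on_connected[OF holf S(1,2) _ S(3)] nonconst
    unfolding constant_on_def by blast
  then have n: "0 < n \<and> (deriv ^^ n) f \<xi> \<noteq> 0" unfolding n_def by (rule LeastI_ex)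
  have nmin: "(deriv ^^ i) f \<xi> = 0" if "0 < i" "i < n" for i
    using not_less_Least[of i "\<lambda>n. 0 < n \<and> (deriv ^^ n) f \<xi> \<noteq> 0"] that unfolding n_def by auto
  obtain g r0 where r0: "r0 > 0" and holg: "g holomorphic_on ball \<xi> r0"
    and geq: "\<And>w. w \<in> ball \<xi> r0 \<Longrightarrow> f w - f \<xi> = ((w - \<xi>) * g w) ^ n"
    and gne: "\<And>w. w \<in> ball \<xi> r0 \<Longrightarrow> g w \<noteq> 0"
    using holomorphic_factor_order_of_zero_strong[OF holf S(1,3), of n] n nmin by metis
  define \<psi> where "\<psi> = (\<lambda>w. (w - \<xi>) * g w)"
  have hol\<psi>: "\<psi> holomorphic_on ball \<xi> r0"
    unfolding \<psi>_def using holg by (intro holomorphic_intros)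
  define a where "a = deriv \<psi> \<xi>"
  have "(g has_field_derivative deriv g \<xi>) (at \<xi>)"
    using holg r0 by (simp add: holomorphic_derivI)
  then have "(\<psi> has_field_derivative g \<xi>) (at \<xi>)"
    unfolding \<psi>_def by (auto intro!: derivative_eq_intros)
  then have "a = g \<xi>" unfolding a_def by (rule DERIV_imp_deriv)
  then have "a \<noteq> 0" using gne[of \<xi>] r0 by simp
  have "continuous_on (ball \<xi> r0) (deriv \<psi>)"
    using hol\<psi> by (intro holomorphic_on_imp_continuous_on holomorphic_deriv) auto
  then have "isCont (deriv \<psi>) \<xi>" using r0 by (simp add: continuous_on_eq_continuous_at)
  then obtain r1 where r1: "r1 > 0" "\<And>w. dist w \<xi> < r1 \<Longrightarrow> dist (deriv \<psi> w) a < cmod a / 2"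
    using \<open>a \<noteq> 0\<close> unfolding continuous_at_eps_delta a_def
    by (metis half_gt_zero_iff zero_less_norm_iff)
  define r where "r = min r0 r1"
  have r: "r > 0" "ball \<xi> r \<subseteq> ball \<xi> r0" using r0 r1 by (auto simp: r_def)
  \<comment> \<open>On this ball \<open>deriv \<psi>\<close> stays within \<open>cmod a / 2\<close>
    of \<open>a\<close>, so \<open>\<psi> z - a * z\<close> has Lipschitz constant
    \<open>cmod a / 2\<close> and the linear part dominates.\<close>
  have bilip: "cmod a / 2 * dist z w \<le> cmod (\<psi> z - \<psi> w)" if "z \<in> ball \<xi> r" "w \<in> ball \<xi> r" for z w
  proof -
    have "cmod ((\<psi> z - a * z) - (\<psi> w - a * w)) \<le> cmod a / 2 * cmod (z - w)"
    proof (rule field_differentiable_bound[of "ball \<xi> r" "\<lambda>z. \<psi> z - a * z" "\<lambda>z. deriv \<psi> z - a"])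
      fix x assume x: "x \<in> ball \<xi> r"
      have "(\<psi> has_field_derivative deriv \<psi> x) (at x)"
        using hol\<psi> x r by (intro holomorphic_derivI[of _ "ball \<xi> r0"]) auto
      then show "((\<lambda>z. \<psi> z - a * z) has_field_derivative deriv \<psi> x - a) (at x within ball \<xi> r)"
        by (auto intro!: derivative_eq_intros intro: has_field_derivative_at_within)
      show "cmod (deriv \<psi> x - a) \<le> cmod a / 2"
        using r1(2)[of x] x by (simp add: r_def dist_commute) (simp add: dist_norm norm_minus_commute)
    qed (use that in auto)
    moreover have "cmod (a * (z - w)) \<le> cmod (\<psi> z - \<psi> w) + cmod ((\<psi> z - a * z) - (\<psi> w - a * w))"
      by (rule order_trans[OF _ norm_triangle_ineq4]) (simp add: algebra_simps)
    ultimately show ?thesis by (simp add: norm_mult dist_norm)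
  qed
  \<comment> \<open>Two points whose values under \<open>\<psi>\<close> are within
    \<open>\<eta>\<close> of the same root have values at most \<open>2 * \<eta>\<close> apart;
    dividing by \<open>cmod a / 2\<close> gives the factor 4.\<close>
  define C where "C = 4 / cmod a"
  have "C > 0" using \<open>a \<noteq> 0\<close> by (simp add: C_def)
  show ?thesis
  proof (rule that[OF r(1) _ \<open>C > 0\<close>])
    show "n > 0" using n by simp
    fix e :: complex and \<delta> :: real assume "\<delta> > 0"
    obtain B where B: "size B = n" "\<And>u. u ^ n - (e - f \<xi>) = (\<Prod>b\<in>#B. u - b)"
      using power_minus_factorization[of n] n by metis
    define \<eta> where "\<eta> = \<delta> powr (1 / real n)"
    have \<eta>: "\<eta> > 0" "\<eta> ^ n = \<delta>"
      using \<open>\<delta> > 0\<close> n by (auto simp: \<eta>_def powr_powr simp flip: powr_realpow)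
    define T where "T = (\<lambda>b. {z \<in> ball \<xi> r. cmod (\<psi> z - b) < \<eta>}) ` set_mset B"
    have "finite T" by (simp add: T_def)
    moreover have "card T \<le> n"
    proof -
      have "card (set_mset D) \<le> size D" for D :: "complex multiset"
        by (induction D) (auto simp: card_insert_if)
      from this[of B] show ?thesis
        unfolding T_def using card_image_le[OF finite_set_mset] B(1) order_trans by blast
    qed
    moreover have "{z \<in> ball \<xi> r. cmod (e - f z) < \<delta>} \<subseteq> \<Union>T"
    proof safe
      fix z assume z: "z \<in> ball \<xi> r" "cmod (e - f z) < \<delta>"
      have "f z - f \<xi> = \<psi> z ^ n" using geq[of z] z r by (auto simp: \<psi>_def)
      then have "\<psi> z ^ n - (e - f \<xi>) = - (e - f z)" by (simp add: algebra_simps)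
      then have "cmod (\<psi> z ^ n - (e - f \<xi>)) < \<delta>" using z by (metis norm_minus_cancel)
      then have "\<not> \<eta> ^ size B \<le> cmod (\<Prod>b\<in>#B. \<psi> z - b)" using B \<eta> by simp
      then obtain b where "b \<in># B" "cmod (\<psi> z - b) < \<eta>"
        using norm_prod_mset_ge_power[of \<eta> B "\<psi> z"] \<eta> by force
      then show "z \<in> \<Union>T" using z by (auto simp: T_def)
    qed
    moreover have "dist z w \<le> C * \<eta>" if "t \<in> T" "z \<in> t" "w \<in> t" for t z w
    proof -
      obtain b where b: "z \<in> ball \<xi> r" "w \<in> ball \<xi> r" "cmod (\<psi> z - b) < \<eta>" "cmod (\<psi> w - b) < \<eta>"
        using \<open>t \<in> T\<close> \<open>z \<in> t\<close> \<open>w \<in> t\<close> by (auto simp: T_def)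
      have "cmod (\<psi> z - \<psi> w) \<le> 2 * \<eta>"
        using norm_triangle_ineq4[of "\<psi> z - b" "\<psi> w - b"] b by simp
      then have "cmod a / 2 * dist z w \<le> 2 * \<eta>" using bilip[OF b(1,2)] by linarith
      then show ?thesis using \<open>a \<noteq> 0\<close> by (simp add: C_def field_simps)
    qed
    ultimately show "diameter_cover n (C * \<delta> powr (1 / real n)) {z \<in> ball \<xi> r. cmod (e - f z) < \<delta>}"
      unfolding diameter_cover_def \<eta>_def by blast
  qed
qed

section \<open>From local covers to a neighbourhood of a compact set\<close>

lemma diameter_cover_mono:
  assumes "diameter_cover n d S" "n \<le> n'" "d \<le> d'" "S' \<subseteq> S"
  shows "diameter_cover n' d' S'"
proof -
  obtain T where "finite T" "card T \<le> n" "S \<subseteq> \<Union>T" "\<forall>t\<in>T. \<forall>z\<in>t. \<forall>w\<in>t. dist z w \<le> d"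
    using assms(1) unfolding diameter_cover_def by blast
  then show ?thesis using assms(2-)
    unfolding diameter_cover_def by (intro exI[of _ T]) fastforce
qed

lemma diameter_cover_UN:
  assumes "finite I" "\<And>i. i \<in> I \<Longrightarrow> diameter_cover (n i) d (S i)"
  shows "diameter_cover (\<Sum>i\<in>I. n i) d (\<Union>i\<in>I. S i)"
proof -
  obtain T where T: "\<And>i. i \<in> I \<Longrightarrow> finite (T i) \<and> card (T i) \<le> n i \<and> S i \<subseteq> \<Union>(T i) \<and>
      (\<forall>t\<in>T i. \<forall>z\<in>t. \<forall>w\<in>t. dist z w \<le> d)"
    using assms(2) unfolding diameter_cover_def by metis
  have "card (\<Union>i\<in>I. T i) \<le> (\<Sum>i\<in>I. card (T i))" using assms(1) card_UN_le by blast
  also have "\<dots> \<le> (\<Sum>i\<in>I. n i)" using T by (intro sum_mono) auto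
  finally show ?thesis
    unfolding diameter_cover_def using T assms(1)
    by (intro exI[of _ "\<Union>i\<in>I. T i"]) (auto, meson subsetD UnionE)
qed

text \<open>Finitely many local covers suffice, and they still cover a neighbourhood of
  \<open>K\<close> of uniform radius. The restriction to \<delta> \<le> 1 makes the local exponents
  comparable: the largest multiplicity gives the weakest bound.\<close>

lemma compact_sublevel_cover:
  assumes holf: "f holomorphic_on S" and S: "open S" "connected S"
    and nonconst: "\<not> f constant_on S" and K: "compact K" "K \<subseteq> S"
  obtains r n C where "r > 0" "n > 0" "C > 0"
    "\<And>e \<delta>. 0 < \<delta> \<Longrightarrow> \<delta> \<le> 1 \<Longrightarrow>
       diameter_cover n (C * \<delta> powr (1 / real n)) {z \<in> (\<Union>x\<in>K. ball x r). cmod (e - f z) < \<delta>}"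
proof -
  define Q where "Q \<xi> r m C \<longleftrightarrow> (\<forall>e \<delta>. \<delta> > 0 \<longrightarrow>
     diameter_cover m (C * \<delta> powr (1 / real m)) {z \<in> ball \<xi> r. cmod (e - f z) < \<delta>})" for \<xi> r m C
  have "\<exists>r m C. r > 0 \<and> m > 0 \<and> C > 0 \<and> Q \<xi> r m C" if "\<xi> \<in> K" for \<xi>
    by (rule local_sublevel_cover[OF holf S subsetD[OF K(2) that] nonconst])
      (unfold Q_def, blast)
  then obtain R m C where Rpos: "\<And>\<xi>. \<xi> \<in> K \<Longrightarrow> R \<xi> > 0" and mpos: "\<And>\<xi>. \<xi> \<in> K \<Longrightarrow> m \<xi> > 0"
    and Cpos: "\<And>\<xi>. \<xi> \<in> K \<Longrightarrow> C \<xi> > 0" and Q: "\<And>\<xi>. \<xi> \<in> K \<Longrightarrow> Q \<xi> (R \<xi>) (m \<xi>) (C \<xi>)"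
    by metis
  have "K \<subseteq> (\<Union>\<xi>\<in>K. ball \<xi> (R \<xi>))" using Rpos centre_in_ball by blast
  then obtain I where I: "I \<subseteq> K" "finite I" "K \<subseteq> (\<Union>\<xi>\<in>I. ball \<xi> (R \<xi>))"
    by (rule compactE_image[OF K(1) open_ball])
  obtain r where r: "r > 0" "(\<Union>x\<in>K. ball x r) \<subseteq> (\<Union>\<xi>\<in>I. ball \<xi> (R \<xi>))"
  proof (rule compact_subset_open_imp_ball_epsilon_subset[OF K(1) _ I(3)])
    show "open (\<Union>\<xi>\<in>I. ball \<xi> (R \<xi>))" by (intro open_UN ballI open_ball)
  qed
  \<comment> \<open>One number serves as cardinality bound and as exponent. The successor keeps it
    positive even when \<open>I\<close> is empty.\<close>
  define n where "n = Suc (\<Sum>\<xi>\<in>I. m \<xi>)"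
  define c where "c = 1 + (\<Sum>\<xi>\<in>I. C \<xi>)"
  have Cnonneg: "0 \<le> C \<xi>" if "\<xi> \<in> I" for \<xi>
    using Cpos[OF subsetD[OF I(1) that]] by simp
  then have "0 \<le> (\<Sum>\<xi>\<in>I. C \<xi>)" by (rule sum_nonneg)
  then have "c > 0" unfolding c_def by linarith
  show ?thesis
  proof (rule that[OF r(1) _ \<open>c > 0\<close>, of n])
    show "n > 0" by (simp add: n_def)
    fix e :: complex and \<delta> :: real assume \<delta>: "0 < \<delta>" "\<delta> \<le> 1"
    have "diameter_cover (m \<xi>) (c * \<delta> powr (1 / real n)) {z \<in> ball \<xi> (R \<xi>). cmod (e - f z) < \<delta>}"
      if "\<xi> \<in> I" for \<xi>
    proof (rule diameter_cover_mono[OF _ order_refl _ order_refl])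
      show "diameter_cover (m \<xi>) (C \<xi> * \<delta> powr (1 / real (m \<xi>))) {z \<in> ball \<xi> (R \<xi>). cmod (e - f z) < \<delta>}"
        using Q[OF subsetD[OF I(1) that]] \<delta>(1) unfolding Q_def by blast
      have "C \<xi> \<le> c"
    proof -
      have "C \<xi> \<le> sum C I"
        by (rule member_le_sum[OF that _ I(2)]) (rule Cnonneg, rule DiffD1)
      then show ?thesis by (simp add: c_def)
    qed
      have "m \<xi> \<le> n" using member_le_sum[OF that, of m] I(2) by (simp add: n_def)
      have "m \<xi> > 0" using mpos I(1) that by auto
      then have "\<delta> powr (1 / real (m \<xi>)) \<le> \<delta> powr (1 / real n)"
        using \<delta> \<open>m \<xi> \<le> n\<close> by (intro powr_mono') (auto simp: field_simps)
      then show "C \<xi> * \<delta> powr (1 / real (m \<xi>)) \<le> c * \<delta> powr (1 / real n)"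
        using \<open>C \<xi> \<le> c\<close> \<open>c > 0\<close> by (intro mult_mono) auto
    qed
    from diameter_cover_UN[OF I(2) this]
    have "diameter_cover (\<Sum>\<xi>\<in>I. m \<xi>) (c * \<delta> powr (1 / real n))
       (\<Union>\<xi>\<in>I. {z \<in> ball \<xi> (R \<xi>). cmod (e - f z) < \<delta>})" .
    then show "diameter_cover n (c * \<delta> powr (1 / real n)) {z \<in> (\<Union>x\<in>K. ball x r). cmod (e - f z) < \<delta>}"
      by (rule diameter_cover_mono[OF _ _ order_refl]) (simp add: n_def, use r(2) in blast)
  qed
qed

section \<open>Log means over horizontal lines\<close>

lemma strip_open: "open {z. \<bar>Im z\<bar> < h}"
proof -
  have "{z. \<bar>Im z\<bar> < h} = {z. Im z < h} \<inter> {z. - h < Im z}" by auto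
  then show ?thesis by (simp add: open_halfspace_Im_gt open_halfspace_Im_lt open_Int)
qed

text \<open>The Cauchy-Riemann equations in real form: moving vertically multiplies the complex
  derivative by the imaginary unit.\<close>

lemma
  assumes "(g has_field_derivative d) (at (Complex x y))"
  shows has_real_derivative_Re_vertical: "((\<lambda>t. Re (g (Complex x t))) has_real_derivative - Im d) (at y)"
    and has_real_derivative_Im_vertical: "((\<lambda>t. Im (g (Complex x t))) has_real_derivative Re d) (at y)"
    and has_real_derivative_Re_horizontal: "((\<lambda>t. Re (g (Complex t y))) has_real_derivative Re d) (at x)"
    and has_real_derivative_Im_horizontal: "((\<lambda>t. Im (g (Complex t y))) has_real_derivative Im d) (at x)"
proof -
  have "(Complex x has_vector_derivative \<i>) (at y)" "((\<lambda>t. Complex t y) has_vector_derivative 1) (at x)"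
    by (auto simp: has_vector_derivative_complex_iff intro!: derivative_eq_intros)
  from field_vector_diff_chain_at[OF this(1) assms] field_vector_diff_chain_at[OF this(2), of g d] assms
  have "((\<lambda>t. g (Complex x t)) has_vector_derivative \<i> * d) (at y)"
    "((\<lambda>t. g (Complex t y)) has_vector_derivative d) (at x)"
    by (simp_all add: o_def)
  then show "((\<lambda>t. Re (g (Complex x t))) has_real_derivative - Im d) (at y)"
    "((\<lambda>t. Im (g (Complex x t))) has_real_derivative Re d) (at y)"
    "((\<lambda>t. Re (g (Complex t y))) has_real_derivative Re d) (at x)"
    "((\<lambda>t. Im (g (Complex t y))) has_real_derivative Im d) (at x)"
    by (auto simp: has_vector_derivative_complex_iff)
qed

lemma deriv_periodic:
  fixes P :: "complex \<Rightarrow> complex"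
  assumes "open S" "P holomorphic_on S" "\<And>z. z \<in> S \<Longrightarrow> z + 1 \<in> S" "\<And>z. z \<in> S \<Longrightarrow> P (z + 1) = P z" "z \<in> S"
  shows "deriv P (z + 1) = deriv P z"
proof -
  have "(P has_field_derivative deriv P (z + 1)) (at (z + 1))"
    using assms by (intro holomorphic_derivI) auto
  then have "((\<lambda>w. P (w + 1)) has_field_derivative deriv P (z + 1)) (at z)"
    by (simp only: DERIV_shift)
  then have "(P has_field_derivative deriv P (z + 1)) (at z)"
    by (rule has_field_derivative_transform_within_open[OF _ assms(1,5)]) (simp add: assms(4))
  then show ?thesis by (simp add: DERIV_imp_deriv)
qed

text \<open>
  With \<open>\<phi> = ln (\<bar>P\<bar>\<^sup>2 + \<epsilon>) / 2\<close>, periodicity kills the integral of \<open>\<phi>\<^sub>x\<^sub>x\<close>, so the second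
  derivative of the mean is the integral of the Laplacian
  \<open>2 \<epsilon> \<bar>P'\<bar>\<^sup>2 / (\<bar>P\<bar>\<^sup>2 + \<epsilon>)\<^sup>2 \<ge> 0\<close>. The regularization by \<open>\<epsilon>\<close> makes zeros of \<open>P\<close> harmless.
\<close>

lemma convex_on_log_mean:
  fixes P :: "complex \<Rightarrow> complex"
  assumes holP: "P holomorphic_on {z. \<bar>Im z\<bar> < h}"
    and per: "\<And>z. \<bar>Im z\<bar> < h \<Longrightarrow> P (z + 1) = P z" and "\<epsilon> > 0"
  shows "convex_on {-h<..<h} (\<lambda>y. integral {0..1} (\<lambda>x. ln ((cmod (P (Complex x y)))\<^sup>2 + \<epsilon>) / 2))"
proof -
  define H where "H = {z. \<bar>Im z\<bar> < h}"
  have "open H" unfolding H_def by (rule strip_open)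
  have inH: "Complex x y \<in> H \<longleftrightarrow> y \<in> {-h<..<h}" for x y by (auto simp: H_def)
  define P1 where "P1 = deriv P"
  define P2 where "P2 = deriv P1"
  have hol: "P holomorphic_on H" "P1 holomorphic_on H" "P2 holomorphic_on H"
    using holP \<open>open H\<close> unfolding P1_def P2_def H_def by (auto intro!: holomorphic_deriv)
  have per': "P (z + 1) = P z" "P1 (z + 1) = P1 z" if "z \<in> H" for z
    using deriv_periodic[OF \<open>open H\<close> hol(1)] per that unfolding P1_def by (auto simp: H_def)
  \<comment> \<open>Real and imaginary parts of \<open>P\<close> and its first two derivatives. The
    height comes first, so that partial application gives the function on one horizontal
    line.\<close>
  define p q a b c d where "p = (\<lambda>y x. Re (P (Complex x y)))" and "q = (\<lambda>y x. Im (P (Complex x y)))"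
    and "a = (\<lambda>y x. Re (P1 (Complex x y)))" and "b = (\<lambda>y x. Im (P1 (Complex x y)))"
    and "c = (\<lambda>y x. Re (P2 (Complex x y)))" and "d = (\<lambda>y x. Im (P2 (Complex x y)))"
  note defs = p_def q_def a_def b_def c_def d_def
  define Q where "Q y x = (p y x)\<^sup>2 + (q y x)\<^sup>2 + \<epsilon>" for y x
  have Qpos: "Q y x > 0" for y x unfolding Q_def using \<open>\<epsilon> > 0\<close> by (intro add_nonneg_pos) auto
  define \<phi> where "\<phi> = (\<lambda>y x. ln (Q y x) / 2)"
  define \<phi>y where "\<phi>y = (\<lambda>y x. (q y x * a y x - p y x * b y x) / Q y x)"
  define \<phi>x where "\<phi>x = (\<lambda>y x. (p y x * a y x + q y x * b y x) / Q y x)"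
  define \<phi>yy where "\<phi>yy = (\<lambda>y x. ((a y x)\<^sup>2 + (b y x)\<^sup>2 - q y x * d y x - p y x * c y x) / Q y x
      - 2 * (q y x * a y x - p y x * b y x)\<^sup>2 / (Q y x)\<^sup>2)"
  define \<phi>xx where "\<phi>xx = (\<lambda>y x. ((a y x)\<^sup>2 + (b y x)\<^sup>2 + q y x * d y x + p y x * c y x) / Q y x
      - 2 * (p y x * a y x + q y x * b y x)\<^sup>2 / (Q y x)\<^sup>2)"
  have dP: "(P has_field_derivative P1 z) (at z)" "(P1 has_field_derivative P2 z) (at z)" if "z \<in> H" for z
    using hol that \<open>open H\<close> unfolding P1_def P2_def by (auto intro: holomorphic_derivI)
  have dy: "((\<lambda>y. p y x) has_real_derivative - b y x) (at y)" "((\<lambda>y. q y x) has_real_derivative a y x) (at y)"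
      "((\<lambda>y. a y x) has_real_derivative - d y x) (at y)" "((\<lambda>y. b y x) has_real_derivative c y x) (at y)"
    and dx: "(p y has_real_derivative a y x) (at x)" "(q y has_real_derivative b y x) (at x)"
      "(a y has_real_derivative c y x) (at x)" "(b y has_real_derivative d y x) (at x)"
    if "y \<in> {-h<..<h}" for y x
    unfolding defs
    using has_real_derivative_Re_vertical[OF dP(1)] has_real_derivative_Im_vertical[OF dP(1)]
      has_real_derivative_Re_vertical[OF dP(2)] has_real_derivative_Im_vertical[OF dP(2)]
      has_real_derivative_Re_horizontal[OF dP(1)] has_real_derivative_Im_horizontal[OF dP(1)]
      has_real_derivative_Re_horizontal[OF dP(2)] has_real_derivative_Im_horizontal[OF dP(2)]
      that inH by auto
  have d\<phi>: "((\<lambda>y. \<phi> y x) has_real_derivative \<phi>y y x) (at y)" if "y \<in> {-h<..<h}" for y x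
    unfolding \<phi>_def \<phi>y_def using Qpos[of y x] unfolding Q_def
    by (auto intro!: derivative_eq_intros dy that simp: field_simps)
  have dQy: "((\<lambda>y. Q y x) has_real_derivative 2 * (q y x * a y x - p y x * b y x)) (at y)"
    and dQx: "(Q y has_real_derivative 2 * (p y x * a y x + q y x * b y x)) (at x)"
    if "y \<in> {-h<..<h}" for y x
    unfolding Q_def by (auto intro!: derivative_eq_intros dy dx that simp: algebra_simps)
  have quotient_eq: "(M * s - N * (2 * N)) / (s * s) = M / s - 2 * N\<^sup>2 / s\<^sup>2" if "s > 0" for M N s :: real
    using that by (simp add: divide_simps power2_eq_square algebra_simps)
  have d\<phi>y: "((\<lambda>y. \<phi>y y x) has_real_derivative \<phi>yy y x) (at y)" if "y \<in> {-h<..<h}" for y x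
    unfolding \<phi>y_def \<phi>yy_def quotient_eq[OF Qpos, symmetric] using Qpos[of y x]
    by (intro DERIV_divide dQy that)
      (auto intro!: derivative_eq_intros dy that simp: algebra_simps power2_eq_square)
  have d\<phi>x: "((\<lambda>x. \<phi>x y x) has_real_derivative \<phi>xx y x) (at x)" if "y \<in> {-h<..<h}" for y x
    unfolding \<phi>x_def \<phi>xx_def quotient_eq[OF Qpos, symmetric] using Qpos[of y x]
    by (intro DERIV_divide dQx that)
      (auto intro!: derivative_eq_intros dx that simp: algebra_simps power2_eq_square)
  have subharmonic: "0 \<le> \<phi>xx y x + \<phi>yy y x" for y x
  proof -
    \<comment> \<open>The terms with the second derivative of \<open>P\<close> cancel, and the two
      subtracted squares add up by (q a - p b)^2 + (p a + q b)^2 = (p^2 + q^2) (a^2 + b^2), which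
      leaves only the contribution of \<open>\<epsilon>\<close>.\<close>
    have "\<phi>xx y x + \<phi>yy y x = 2 * ((a y x)\<^sup>2 + (b y x)\<^sup>2) * \<epsilon> / (Q y x)\<^sup>2"
      unfolding \<phi>xx_def \<phi>yy_def using Qpos[of y x]
      by (simp add: divide_simps) (simp add: Q_def algebra_simps power2_eq_square)
    also have "\<dots> \<ge> 0" using \<open>\<epsilon> > 0\<close> by simp
    finally show ?thesis .
  qed
  have contC: "continuous_on ({-h<..<h} \<times> UNIV) (\<lambda>z. g (Complex (snd z) (fst z)))"
    if "g holomorphic_on H" for g
    by (rule continuous_on_compose2[OF holomorphic_on_imp_continuous_on[OF that]])
      (auto simp: H_def Complex_eq intro!: continuous_intros)
  have cont: "continuous_on ({-h<..<h} \<times> UNIV) (\<lambda>z. u (fst z) (snd z))" if "u \<in> {p, q, a, b, c, d}" for u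
    using that unfolding defs by (auto intro!: continuous_intros contC hol)
  have contQ: "continuous_on ({-h<..<h} \<times> UNIV) (\<lambda>z. Q (fst z) (snd z))"
    unfolding Q_def by (intro continuous_intros cont) auto
  have Qne: "Q y x \<noteq> 0" for y x using Qpos[of y x] by simp
  note cont_simps = cont[of p, simplified] cont[of q, simplified] cont[of a, simplified]
    cont[of b, simplified] cont[of c, simplified] cont[of d, simplified] contQ
  have "continuous_on ({-h<..<h} \<times> UNIV) (\<lambda>z. \<phi> (fst z) (snd z))"
    unfolding \<phi>_def by (intro continuous_on_divide continuous_on_ln cont_simps continuous_on_const) (auto simp: Qne)
  moreover have "continuous_on ({-h<..<h} \<times> UNIV) (\<lambda>z. \<phi>y (fst z) (snd z))"
    unfolding \<phi>y_def by (intro continuous_on_divide continuous_on_diff continuous_on_mult cont_simps) (auto simp: Qne)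
  moreover have "continuous_on ({-h<..<h} \<times> UNIV) (\<lambda>z. \<phi>yy (fst z) (snd z))"
    unfolding \<phi>yy_def by (intro continuous_on_divide continuous_on_diff continuous_on_add continuous_on_mult
      continuous_on_power cont_simps continuous_on_const) (auto simp: Qne)
  moreover have "continuous_on ({-h<..<h} \<times> UNIV) (\<lambda>z. \<phi>xx (fst z) (snd z))"
    unfolding \<phi>xx_def by (intro continuous_on_divide continuous_on_diff continuous_on_add continuous_on_mult
      continuous_on_power cont_simps continuous_on_const) (auto simp: Qne)
  ultimately have cont\<phi>: "continuous_on ({-h<..<h} \<times> UNIV) (\<lambda>z. u (fst z) (snd z))" if "u \<in> {\<phi>, \<phi>y, \<phi>yy, \<phi>xx}" for u
    using that by blast
  have cont_y: "continuous_on {0..1} (u y)" if "u \<in> {\<phi>, \<phi>y, \<phi>yy, \<phi>xx}" "y \<in> {-h<..<h}" for u y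
  proof -
    have "continuous_on {0..1} (\<lambda>x. u (fst (y, x)) (snd (y, x)))"
      by (rule continuous_on_compose2[OF cont\<phi>[OF that(1)]])
        (use that(2) in \<open>auto intro!: continuous_on_Pair continuous_on_const continuous_on_id\<close>)
    then show ?thesis by simp
  qed
  have int: "u y integrable_on {0..1}" if "u \<in> {\<phi>, \<phi>y, \<phi>yy, \<phi>xx}" "y \<in> {-h<..<h}" for u y
    using integrable_continuous_real cont_y[OF that] by blast
  have leibniz: "((\<lambda>y. integral {0..1} (u y)) has_real_derivative integral {0..1} (u' y)) (at y)"
    if "u \<in> {\<phi>, \<phi>y, \<phi>yy, \<phi>xx}" "u' \<in> {\<phi>, \<phi>y, \<phi>yy, \<phi>xx}" "y \<in> {-h<..<h}"
      and "\<And>x y. y \<in> {-h<..<h} \<Longrightarrow> ((\<lambda>y. u y x) has_real_derivative u' y x) (at y)" for u u' y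
  proof -
    have "((\<lambda>y. integral (cbox 0 1) (u y)) has_real_derivative integral (cbox 0 1) (u' y)) (at y within {-h<..<h})"
    proof (rule leibniz_rule_field_derivative)
      show "continuous_on ({-h<..<h} \<times> cbox 0 1) (\<lambda>(y, x). u' y x)"
        using continuous_on_subset[OF cont\<phi>[OF that(2)], of "{-h<..<h} \<times> cbox 0 1"]
        by (auto simp: case_prod_unfold)
    qed (use that int in \<open>auto intro: has_field_derivative_at_within\<close>)
    then show ?thesis using that(3) by (simp add: at_within_open[OF that(3)])
  qed
  have "convex_on {-h<..<h} (\<lambda>y. integral {0..1} (\<phi> y))"
  proof (rule f''_ge0_imp_convex)
    show "convex {-h<..<h}" by simp
    fix y assume y: "y \<in> {-h<..<h}"
    show "((\<lambda>y. integral {0..1} (\<phi> y)) has_real_derivative integral {0..1} (\<phi>y y)) (at y)"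
      by (rule leibniz) (use y d\<phi> in auto)
    show "((\<lambda>y. integral {0..1} (\<phi>y y)) has_real_derivative integral {0..1} (\<phi>yy y)) (at y)"
      by (rule leibniz) (use y d\<phi>y in auto)
    have "(\<phi>xx y has_integral \<phi>x y 1 - \<phi>x y 0) {0..1}"
      by (rule fundamental_theorem_of_calculus)
        (simp, rule has_vector_derivative_at_within,
          rule d\<phi>x[OF y, unfolded has_real_derivative_iff_has_vector_derivative])
    moreover have "\<phi>x y 1 = \<phi>x y 0"
    proof -
      have "Complex 0 y + 1 = Complex 1 y" by (simp add: complex_eq_iff)
      then have "P (Complex 1 y) = P (Complex 0 y)" "P1 (Complex 1 y) = P1 (Complex 0 y)"
        using per'[of "Complex 0 y"] y inH[of 0 y] by simp_all
      then show ?thesis unfolding \<phi>x_def Q_def defs by simp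
    qed
    ultimately have "integral {0..1} (\<phi>xx y) = 0" by (simp add: integral_unique)
    then have "integral {0..1} (\<phi>yy y) = integral {0..1} (\<lambda>x. \<phi>xx y x + \<phi>yy y x)"
      using int[of \<phi>xx y] int[of \<phi>yy y] y by (subst integral_add) auto
    also have "\<dots> \<ge> 0" using subharmonic by (intro integral_nonneg integrable_add int y) auto
    finally show "0 \<le> integral {0..1} (\<phi>yy y)" .
  qed
  then show ?thesis
    unfolding \<phi>_def Q_def p_def q_def by (simp add: cmod_power2)
qed

section \<open>Integrability of logarithms\<close>

lemma set_integrable_unit_interval:
  "continuous_on UNIV g \<Longrightarrow> set_integrable lborel {0..1} (g :: real \<Rightarrow> real)"
  by (rule borel_integrable_atLeastAtMost') (rule continuous_on_subset, auto)

section \<open>From metric covers to measure bounds and negative moments\<close>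

lemma diameter_cover_image:
  assumes "diameter_cover n d S" "\<And>z w. dist (g z) (g w) \<le> dist z w"
  shows "diameter_cover n d (g ` S)"
proof -
  obtain T where T': "finite T" "card T \<le> n" "S \<subseteq> \<Union>T" "\<forall>t\<in>T. \<forall>z\<in>t. \<forall>w\<in>t. dist z w \<le> d"
    using assms(1) unfolding diameter_cover_def by (elim exE conjE) (rule that)
  have T: "finite T" "card T \<le> n" "S \<subseteq> \<Union>T" "\<And>t z w. t \<in> T \<Longrightarrow> z \<in> t \<Longrightarrow> w \<in> t \<Longrightarrow> dist z w \<le> d"
    using T' by auto
  have "card ((`) g ` T) \<le> n" using card_image_le[OF T(1), of "(`) g"] T(2) by linarith
  moreover have "g ` S \<subseteq> \<Union>((`) g ` T)" using T(3) by blast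
  moreover have "dist x y \<le> d" if "t \<in> (`) g ` T" "x \<in> t" "y \<in> t" for t x y
    using that by (auto intro: order_trans[OF assms(2) T(4)])
  ultimately show ?thesis
    unfolding diameter_cover_def using T(1) by (intro exI[of _ "(`) g ` T"]) simp
qed

text \<open>A set of diameter at most \<open>d\<close> lies in the interval of radius
  \<open>d\<close> about any of its points. The covered set and the covering sets may be
  nonmeasurable, hence the measurable superset \<open>U\<close>.\<close>

lemma diameter_cover_measure:
  fixes S :: "real set"
  assumes "diameter_cover n d S" "d \<ge> 0"
  obtains U where "U \<in> sets lborel" "S \<subseteq> U" "emeasure lborel U \<le> ennreal (real n * (2 * d))"
proof -
  obtain T where T': "finite T" "card T \<le> n" "S \<subseteq> \<Union>T" "\<forall>t\<in>T. \<forall>z\<in>t. \<forall>w\<in>t. dist z w \<le> d"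
    using assms(1) unfolding diameter_cover_def by (elim exE conjE) (rule that)
  have T: "finite T" "card T \<le> n" "S \<subseteq> \<Union>T" "\<And>t z w. t \<in> T \<Longrightarrow> z \<in> t \<Longrightarrow> w \<in> t \<Longrightarrow> dist z w \<le> d"
    using T' by auto
  define J where "J t = {(SOME x. x \<in> t) - d .. (SOME x. x \<in> t) + d}" for t :: "real set"
  have J: "t \<subseteq> J t" if "t \<in> T" for t
  proof
    fix x assume "x \<in> t"
    then have "(SOME x. x \<in> t) \<in> t" by (rule someI)
    from T(4)[OF that this \<open>x \<in> t\<close>] show "x \<in> J t" by (auto simp: J_def dist_real_def)
  qed
  show ?thesis
  proof (rule that)
    show "(\<Union>t\<in>T. J t) \<in> sets lborel" using T(1) by (auto simp: J_def)
    show "S \<subseteq> (\<Union>t\<in>T. J t)" using T(3) J by blast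
    have "emeasure lborel (\<Union>t\<in>T. J t) \<le> (\<Sum>t\<in>T. emeasure lborel (J t))"
      using T(1) by (intro emeasure_subadditive_finite) (auto simp: J_def)
    also have "\<dots> = (\<Sum>t\<in>T. ennreal (2 * d))"
      using assms(2) by (intro sum.cong) (auto simp: J_def)
    also have "\<dots> = ennreal (real (card T) * (2 * d))"
      using assms(2) by (simp add: ennreal_mult' ennreal_of_nat_eq_real_of_nat)
    also have "\<dots> \<le> ennreal (real n * (2 * d))"
      using T(2) assms(2) by (intro ennreal_leI mult_right_mono) auto
    finally show "emeasure lborel (\<Union>t\<in>T. J t) \<le> ennreal (real n * (2 * d))" .
  qed
qed

text \<open>A dyadic layer decomposition: for 2^(-k-1) \<le> s < 2^(-k) the summand with index k
  alone dominates, and 1 takes care of s \<ge> 1. At s = 0 the left side is 0, since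
  \<open>0 powr - p = 0\<close>.\<close>

lemma powr_minus_le_dyadic:
  fixes s p :: real
  assumes "s \<ge> 0" "p > 0"
  shows "ennreal (s powr - p) \<le> 1 + (\<Sum>k. ennreal (2 powr (real (Suc k) * p)) * indicator {x. x < (1/2) ^ k} s)"
    (is "_ \<le> 1 + (\<Sum>k. ?f k)")
proof -
  consider "s = 0" | "s \<ge> 1" | "0 < s" "s < 1" using assms by linarith
  then show ?thesis
  proof cases
    case 2
    then have "s powr - p \<le> 1" using assms powr_mono2'[of "- p" 1 s] by simp
    then have "ennreal (s powr - p) \<le> 1" by (simp add: ennreal_le_1)
    then show ?thesis by (rule order_trans) simp
  next
    case 3
    define j where "j = (LEAST j. (1/2) ^ j \<le> s)"
    have "\<exists>j. (1/2) ^ j < s" using real_arch_pow_inv[OF 3(1), of "1/2"] by simp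
    then have "\<exists>j. (1/2) ^ j \<le> s" using less_imp_le by blast
    then have j: "(1/2) ^ j \<le> s" unfolding j_def by (rule LeastI_ex)
    then have "j \<noteq> 0" using 3 by (intro notI) simp
    then obtain k where k: "j = Suc k" using not0_implies_Suc by blast
    have "\<not> (1/2) ^ k \<le> s" using not_less_Least[of k "\<lambda>j. (1/2) ^ j \<le> s"] k j_def by simp
    then have "s < (1/2) ^ k" by simp
    have "s powr - p \<le> ((1/2) ^ j) powr - p" using j 3 assms by (intro powr_mono2') auto
    also have "(1/2::real) ^ j = 2 powr - real j" by (simp add: powr_minus powr_realpow power_divide divide_simps)
    also have "(2 powr - real j) powr - p = 2 powr (real (Suc k) * p)" by (simp add: powr_powr k algebra_simps)
    finally have "ennreal (s powr - p) \<le> ?f k" using \<open>s < (1/2) ^ k\<close> by (simp add: ennreal_leI)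
    also have "?f k = sum ?f {k}"
      by (simp only: sum.insert finite.emptyI empty_iff not_False_eq_True sum.empty add_0_right)
    also have "\<dots> \<le> (\<Sum>k. ?f k)" by (rule sum_le_suminf) auto
    also have "\<dots> \<le> 1 + (\<Sum>k. ?f k)" by (simp add: add_increasing)
    finally show ?thesis .
  qed simp
qed

text \<open>Sublevel sets decay with exponent 2p while only the moment of order p is taken; the
  surplus turns the dyadic sum into a geometric series of ratio \<open>2 powr - p\<close>.\<close>

lemma nn_integral_powr_minus_le:
  fixes g :: "real \<Rightarrow> real"
  assumes meas[measurable]: "g \<in> borel_measurable borel" and nonneg: "\<And>x. g x \<ge> 0" and "B \<ge> 0" "p > 0"
    and sublevel: "\<And>\<delta>. 0 < \<delta> \<Longrightarrow> \<delta> \<le> 1 \<Longrightarrow>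
      emeasure lborel {x \<in> {0..1}. g x < \<delta>} \<le> ennreal (B * \<delta> powr (2 * p))"
  shows "(\<integral>\<^sup>+x. ennreal (g x powr - p) * indicator {0..1} x \<partial>lborel)
    \<le> ennreal (1 + B * 2 powr p / (1 - 2 powr - p))"
proof -
  let ?F = "\<lambda>k x. ennreal (2 powr (real (Suc k) * p)) * indicator {x \<in> {0..1}. g x < (1/2) ^ k} x"
  have "(\<integral>\<^sup>+x. ennreal (g x powr - p) * indicator {0..1} x \<partial>lborel)
    \<le> (\<integral>\<^sup>+x. indicator {0..1} x + (\<Sum>k. ?F k x) \<partial>lborel)"
  proof (rule nn_integral_mono)
    fix x
    show "ennreal (g x powr - p) * indicator {0..1} x \<le> indicator {0..1} x + (\<Sum>k. ?F k x)"
      using powr_minus_le_dyadic[OF nonneg[of x] \<open>p > 0\<close>] by (auto simp: indicator_def split: if_splits)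
  qed
  also have "\<dots> = 1 + (\<Sum>k. \<integral>\<^sup>+x. ?F k x \<partial>lborel)"
    by (subst nn_integral_add) (auto simp: nn_integral_suminf)
  also have "(\<Sum>k. \<integral>\<^sup>+x. ?F k x \<partial>lborel) \<le> (\<Sum>k. ennreal (B * 2 powr p * (2 powr - p) ^ k))"
  proof (rule suminf_le)
    fix k
    have "(\<integral>\<^sup>+x. ?F k x \<partial>lborel) = ennreal (2 powr (real (Suc k) * p)) * emeasure lborel {x \<in> {0..1}. g x < (1/2) ^ k}"
      by (subst nn_integral_cmult_indicator) auto
    also have "\<dots> \<le> ennreal (2 powr (real (Suc k) * p)) * ennreal (B * ((1/2) ^ k) powr (2 * p))"
      by (intro mult_left_mono sublevel) (auto simp: power_le_one)
    also have "\<dots> = ennreal (2 powr (real (Suc k) * p) * (B * ((1/2) ^ k) powr (2 * p)))"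
      using \<open>B \<ge> 0\<close> by (subst ennreal_mult) auto
    also have "((1/2::real) ^ k) powr (2 * p) = 2 powr (- real k * (2 * p))"
    proof -
      have "(1/2::real) ^ k = 2 powr - real k" by (simp add: powr_minus powr_realpow power_divide divide_simps)
      then show ?thesis by (simp add: powr_powr)
    qed
    also have "2 powr (real (Suc k) * p) * (B * 2 powr (- real k * (2 * p))) = B * 2 powr p * (2 powr - p) ^ k"
    proof -
      have "(2 powr - p) ^ k = 2 powr (- p * real k)" by (simp add: powr_powr flip: powr_realpow)
      then show ?thesis by (simp add: algebra_simps flip: powr_add)
    qed
    finally show "(\<integral>\<^sup>+x. ?F k x \<partial>lborel) \<le> ennreal (B * 2 powr p * (2 powr - p) ^ k)" .
  qed auto
  also have "(\<Sum>k. ennreal (B * 2 powr p * (2 powr - p) ^ k)) = ennreal (B * 2 powr p * (1 / (1 - 2 powr - p)))"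
  proof (rule suminf_ennreal_eq)
    have "2 powr - p < (2::real) powr 0" using \<open>p > 0\<close> by (intro powr_less_mono) auto
    then show "(\<lambda>k. B * 2 powr p * (2 powr - p) ^ k) sums (B * 2 powr p * (1 / (1 - 2 powr - p)))"
      by (intro sums_mult geometric_sums) simp
  qed (use \<open>B \<ge> 0\<close> in auto)
  also have "1 + \<dots> = ennreal (1 + B * 2 powr p / (1 - 2 powr - p))"
  proof -
    have "2 powr - p < (2::real) powr 0" using \<open>p > 0\<close> by (intro powr_less_mono) auto
    then show ?thesis using \<open>B \<ge> 0\<close> by (subst ennreal_plus) (auto intro!: divide_nonneg_nonneg)
  qed
  finally show ?thesis by (simp add: add_left_mono)
qed

text \<open>The zero set lies in every sublevel set. Its nullity is recorded separately because the
  convention \<open>0 powr - p = 0\<close> makes the moment bound blind to zeros.\<close>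

lemma AE_nonzero_of_sublevel:
  fixes g :: "real \<Rightarrow> real"
  assumes meas[measurable]: "g \<in> borel_measurable borel" and "p > 0"
    and sublevel: "\<And>\<delta>. 0 < \<delta> \<Longrightarrow> \<delta> \<le> 1 \<Longrightarrow>
      emeasure lborel {x \<in> {0..1}. g x < \<delta>} \<le> ennreal (B * \<delta> powr p)"
  shows "AE x in lborel. x \<in> {0..1} \<longrightarrow> g x \<noteq> 0"
proof -
  have "(\<lambda>k. B * inverse (real (Suc k)) powr p) \<longlonglongrightarrow> B * 0 powr p"
    using \<open>p > 0\<close> LIMSEQ_inverse_real_of_nat
    by (intro tendsto_mult tendsto_const tendsto_powr2) auto
  then have "(\<lambda>k. ennreal (B * inverse (real (Suc k)) powr p)) \<longlonglongrightarrow> 0"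
    by (intro tendsto_ennrealI[where x = 0, simplified]) simp
  moreover have "emeasure lborel {x \<in> {0..1}. g x = 0} \<le> ennreal (B * inverse (real (Suc k)) powr p)" for k
    by (rule order_trans[OF emeasure_mono sublevel]) (auto simp: field_simps)
  ultimately have "emeasure lborel {x \<in> {0..1}. g x = 0} \<le> 0"
    by (intro LIMSEQ_le_const) auto
  then have "{x \<in> {0..1}. g x = 0} \<in> null_sets lborel" by (intro null_setsI) auto
  then show ?thesis by (rule AE_I') auto
qed

text \<open>For t \<le> 1 the power dominates \<open>t\<close> itself. For larger t, split off
  \<open>ln t\<close>, which costs the term 1/p, while the remaining \<open>ln (1 + 1 / t)\<close>
  is at most 1 and hence at most \<open>t powr p\<close>.\<close>

lemma ln_one_plus_le_powr:
  fixes t p :: real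
  assumes "t \<ge> 0" "0 < p" "p \<le> 1"
  shows "ln (1 + t) \<le> (1 + 1 / p) * t powr p"
proof (cases "t \<le> 1")
  case True
  have "ln (1 + t) \<le> t" using assms ln_add_one_self_le_self by simp
  also have "t \<le> t powr p" using powr_mono'[of p 1 t] assms True by simp
  also have "\<dots> \<le> (1 + 1 / p) * t powr p" using assms by (simp add: algebra_simps)
  finally show ?thesis .
next
  case False
  then have "1 + t = (1 + 1 / t) * t" by (simp add: field_simps)
  then have "ln (1 + t) = ln (1 + 1 / t) + ln t" using False by (metis ln_mult_pos add_pos_pos divide_pos_pos zero_less_one not_le order_less_trans)
  also have "ln (1 + 1 / t) \<le> 1"
    using ln_add_one_self_le_self[of "1/t"] False by (smt (verit) divide_le_eq_1 divide_nonneg_nonneg)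
  also have "ln t = ln (t powr p) / p" using False assms by (simp add: ln_powr)
  also have "ln (t powr p) \<le> t powr p" using False by (intro order.strict_implies_order ln_less_self) simp
  also have "1 \<le> t powr p" using False assms by (simp add: ge_one_powr_ge_zero)
  finally show ?thesis using assms by (simp add: algebra_simps divide_right_mono)
qed

text \<open>
  Negative moments rather than sublevel bounds are kept, since \<open>ln (1 + \<kappa> / g)\<close> is at most a constant
  times \<open>\<kappa> powr p * g powr - p\<close>.
\<close>

locale powr_integrable =
  fixes g :: "real \<Rightarrow> real" and p K :: real
  assumes cont: "continuous_on UNIV g" and nonneg: "\<And>x. g x \<ge> 0" and p: "0 < p" "p \<le> 1"
    and AE_nonzero: "AE x in lborel. x \<in> {0..1} \<longrightarrow> g x \<noteq> 0"
    and nn_integral_le: "(\<integral>\<^sup>+x. ennreal (g x powr - p) * indicator {0..1} x \<partial>lborel) \<le> ennreal K"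
    and K: "K \<ge> 0"
begin

lemma borel_measurable[measurable]: "g \<in> borel_measurable borel"
  using cont by (rule borel_measurable_continuous_onI)

lemma
  shows set_integrable_powr: "set_integrable lborel {0..1} (\<lambda>x. g x powr - p)"
    and set_lebesgue_integral_powr_le: "(LINT x:{0..1}|lborel. g x powr - p) \<le> K"
proof -
  have eq: "ennreal (indicator {0..1} x *\<^sub>R g x powr - p) = ennreal (g x powr - p) * indicator {0..1} x" for x
    by (auto simp: indicator_def)
  show "set_integrable lborel {0..1} (\<lambda>x. g x powr - p)"
    unfolding set_integrable_def
    by (rule integrableI_nonneg) (use nn_integral_le in \<open>auto simp: eq[simplified] simp del: of_bool_def intro: le_less_trans[OF _ ennreal_less_top]\<close>)
  show "(LINT x:{0..1}|lborel. g x powr - p) \<le> K"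
    unfolding set_lebesgue_integral_def
    by (rule integral_real_bounded[OF K]) (use nn_integral_le in \<open>simp only: eq\<close>)
qed

text \<open>Large values are controlled by \<open>ln (g x) \<le> g x\<close>, small ones by the
  negative moment, since -p ln g \<le> g^(-p).\<close>

lemma set_integrable_ln: "set_integrable lborel {0..1} (\<lambda>x. ln (g x))"
proof (rule set_integrable_bound)
  show "set_integrable lborel {0..1} (\<lambda>x. g x + g x powr - p / p)"
    by (intro set_integral_add set_integrable_divide set_integrable_powr set_integrable_unit_interval cont)
  show "set_borel_measurable lborel {0..1} (\<lambda>x. ln (g x))"
    unfolding set_borel_measurable_def by measurable
  show "AE x in lborel. x \<in> {0..1} \<longrightarrow> norm (ln (g x)) \<le> norm (g x + g x powr - p / p)"
  proof (intro AE_I2 impI)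
    fix x
    have "\<bar>ln (g x)\<bar> \<le> g x + g x powr - p / p"
    proof (cases "g x = 0")
      case False
      then have "g x > 0" using nonneg[of x] by simp
      then have "- p * ln (g x) = ln (g x powr - p)" by (simp add: ln_powr)
      also have "\<dots> \<le> g x powr - p" using \<open>g x > 0\<close> by (intro order.strict_implies_order ln_less_self) simp
      finally have "- ln (g x) \<le> g x powr - p / p" using p by (simp add: field_simps)
      moreover have "ln (g x) \<le> g x" using \<open>g x > 0\<close> by (intro order.strict_implies_order ln_less_self)
      moreover have "g x powr - p / p \<ge> 0" using p by simp
      ultimately show ?thesis using \<open>g x > 0\<close> by linarith
    qed simp
    then show "norm (ln (g x)) \<le> norm (g x + g x powr - p / p)" by simp
  qed
qed

lemma set_lebesgue_integral_ln_add_le: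
  assumes "0 < \<kappa>" "\<kappa> \<le> 1"
  shows "(LINT x:{0..1}|lborel. ln (g x + \<kappa>)) \<le> (LINT x:{0..1}|lborel. ln (g x)) + (1 + 1 / p) * K * \<kappa> powr p"
proof -
  have "(LINT x:{0..1}|lborel. ln (g x + \<kappa>))
    \<le> (LINT x:{0..1}|lborel. ln (g x) + (1 + 1 / p) * \<kappa> powr p * g x powr - p)"
  proof (rule set_integral_mono)
    show "set_integrable lborel {0..1} (\<lambda>x. ln (g x + \<kappa>))"
      by (rule set_integrable_unit_interval) (intro continuous_intros cont ballI, use nonneg assms in \<open>simp add: add_nonneg_pos less_imp_neq[symmetric]\<close>)
    show "set_integrable lborel {0..1} (\<lambda>x. ln (g x) + (1 + 1 / p) * \<kappa> powr p * g x powr - p)"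
      by (intro set_integral_add set_integrable_ln set_integrable_mult_right set_integrable_powr)
    fix x
    show "ln (g x + \<kappa>) \<le> ln (g x) + (1 + 1 / p) * \<kappa> powr p * g x powr - p"
    proof (cases "g x = 0")
      \<comment> \<open>Here \<open>ln 0\<close> and \<open>0 powr - p\<close> both take the value
        0, and the claim reduces to \<open>ln \<kappa> \<le> 0\<close>; this is where \<kappa> \<le>
        1 enters.\<close>
      case True
      then show ?thesis using assms by simp
    next
      case False
      then have "g x > 0" using nonneg[of x] by simp
      then have "ln (g x + \<kappa>) = ln (g x) + ln (1 + \<kappa> / g x)"
        using assms by (subst ln_mult_pos[symmetric]) (auto simp: field_simps add_pos_pos)
      also have "ln (1 + \<kappa> / g x) \<le> (1 + 1 / p) * (\<kappa> / g x) powr p"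
        using \<open>g x > 0\<close> assms p by (intro ln_one_plus_le_powr) auto
      also have "(\<kappa> / g x) powr p = \<kappa> powr p * g x powr - p"
        using \<open>g x > 0\<close> assms by (simp add: powr_divide powr_minus divide_simps)
      finally show ?thesis by (simp add: algebra_simps)
    qed
  qed
  also have "\<dots> = (LINT x:{0..1}|lborel. ln (g x)) + (1 + 1 / p) * \<kappa> powr p * (LINT x:{0..1}|lborel. g x powr - p)"
    by (subst set_integral_add(2)) (auto intro!: set_integrable_ln set_integrable_mult_right set_integrable_powr)
  also have "(1 + 1 / p) * \<kappa> powr p * (LINT x:{0..1}|lborel. g x powr - p) \<le> (1 + 1 / p) * \<kappa> powr p * K"
    using set_lebesgue_integral_powr_le p by (intro mult_left_mono) auto
  finally show ?thesis by (simp add: algebra_simps)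
qed

end

section \<open>Lyapunov exponents of Schroedinger cocycles\<close>

text \<open>Fekete's lemma. Nonnegativity keeps the infimum finite and permits replacing
  \<open>n div m\<close> by the quotient n / m.\<close>

lemma subadditive_convergent:
  fixes u :: "nat \<Rightarrow> real"
  assumes subadd: "\<And>m n. u (m + n) \<le> u m + u n" and nonneg: "\<And>n. u n \<ge> 0"
  shows "convergent (\<lambda>n. u n / real n)"
proof -
  define L where "L = (INF n\<in>{1..}. u n / real n)"
  have bdd: "bdd_below ((\<lambda>n. u n / real n) ` {1..})"
    using nonneg by (auto intro!: bdd_belowI[of _ 0])
  have L_le: "L \<le> u n / real n" if "n \<ge> 1" for n
    unfolding L_def using bdd that by (auto intro: cINF_lower)
  have mult: "u (q * m) \<le> real q * u m" if "q \<ge> 1" for q m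
    using that
  proof (induction q rule: dec_induct)
    case (step q)
    then show ?case using subadd[of m "q * m"] by (simp add: algebra_simps)
  qed simp
  have "(\<lambda>n. u n / real n) \<longlonglongrightarrow> L"
  proof (rule LIMSEQ_I)
    fix \<epsilon> :: real assume "\<epsilon> > 0"
    have "\<exists>m\<in>{1..}. u m / real m < L + \<epsilon> / 2"
      using cINF_less_iff[of "{1..}" "\<lambda>n. u n / real n" "L + \<epsilon> / 2"] bdd \<open>\<epsilon> > 0\<close> unfolding L_def by auto
    then obtain m where m: "m \<ge> 1" "u m / real m < L + \<epsilon> / 2" by auto
    \<comment> \<open>Bounds the contribution of the remainder \<open>n mod m\<close> independently
      of \<open>n\<close>.\<close>
    define B where "B = (\<Sum>r<m. u r)"
    have B: "u r \<le> B" if "r < m" for r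
      unfolding B_def using that nonneg by (intro member_le_sum) auto
    obtain n0 where n0: "real n0 > 2 * B / \<epsilon>" using reals_Archimedean2 by blast
    show "\<exists>no. \<forall>n\<ge>no. norm (u n / real n - L) < \<epsilon>"
    proof (intro exI allI impI)
      fix n assume n: "n \<ge> max m (Suc n0)"
      then have "n div m \<ge> 1" using m(1) by (simp add: Suc_leI div_greater_zero_iff)
      have "u n \<le> u (n div m * m) + u (n mod m)"
        using subadd[of "n div m * m" "n mod m"] by simp
      also have "\<dots> \<le> real (n div m) * u m + B"
        using mult[OF \<open>n div m \<ge> 1\<close>, of m] B[of "n mod m"] m(1) by (intro add_mono) auto
      also have "real (n div m) * u m \<le> real n / real m * u m"
        using nonneg by (intro mult_right_mono of_nat_div_le_of_nat) auto
      finally have "u n / real n \<le> u m / real m + B / real n"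
        using n m(1) by (simp add: field_simps)
      moreover have "B / real n < \<epsilon> / 2"
      proof -
        have "2 * B / \<epsilon> < real n" using n0 n by linarith
        then show ?thesis using \<open>\<epsilon> > 0\<close> n m(1) by (simp add: field_simps)
      qed
      moreover have "L \<le> u n / real n" using L_le n m(1) by simp
      ultimately show "norm (u n / real n - L) < \<epsilon>" using m(2) unfolding real_norm_def by linarith
    qed
  qed
  then show ?thesis by (rule convergentI)
qed

section \<open>Translation invariance on the circle\<close>

lemma periodic_shift_int:
  fixes g :: "real \<Rightarrow> 'a"
  assumes "\<And>x. g (x + 1) = g x"
  shows "g (x + of_int k) = g x"
proof (induction k rule: int_induct[where k = 0])
  case (step1 i)
  then show ?case using assms[of "x + of_int i"] by (simp add: algebra_simps)
next
  case (step2 i)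
  then show ?case using assms[of "x + of_int (i - 1)"] by (simp add: algebra_simps)
qed simp

text \<open>Only the fractional part of \<open>c\<close> matters, and the piece of the shifted
  interval beyond 1 is moved back by one period.\<close>

lemma integral_periodic_shift:
  fixes g :: "real \<Rightarrow> real"
  assumes cont: "continuous_on UNIV g" and per: "\<And>x. g (x + 1) = g x"
  shows "(LINT x:{0..1}|lborel. g (x + c)) = (LINT x:{0..1}|lborel. g x)"
proof -
  have cont': "continuous_on S g" for S using cont continuous_on_subset by blast
  have int: "g integrable_on {a..b}" for a b using cont' integrable_continuous_real by blast
  define t where "t = frac c"
  have t: "0 \<le> t" "t \<le> 1" unfolding t_def using frac_lt_1[of c] by auto
  have gc: "g (x + c) = g (x + t)" for x
    using periodic_shift_int[of g, OF per, of "x + t" "\<lfloor>c\<rfloor>"] by (simp add: t_def frac_def)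
  have shift: "integral {a..b} (\<lambda>x. g (x + d)) = integral {a + d..b + d} g" for a b d
    using integral_shift[OF cont', of a b d] by (simp add: o_def)
  have "integral {0..1} (\<lambda>x. g (x + t)) = integral {t..1 + t} g" using shift[of 0 1 t] by simp
  also have "\<dots> = integral {t..1} g + integral {1..1 + t} g"
    using t by (intro Henstock_Kurzweil_Integration.integral_combine[symmetric] int) auto
  also have "integral {1..1 + t} g = integral {0..t} g"
    using shift[of 0 t 1] per by (simp add: add.commute)
  also have "integral {t..1} g + integral {0..t} g = integral {0..1} g"
    using t Henstock_Kurzweil_Integration.integral_combine[OF _ _ int, of 0 t 1] by simp
  finally have "integral {0..1} (\<lambda>x. g (x + c)) = integral {0..1} g" by (simp add: gc)
  moreover have "continuous_on UNIV (\<lambda>x. g (x + c))"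
    by (rule continuous_on_compose2[OF cont]) (auto intro!: continuous_intros)
  ultimately show ?thesis
    by (simp add: set_borel_integral_eq_integral(2) set_integrable_unit_interval cont)
qed

section \<open>Operator norms of real 2 by 2 matrices\<close>

lemma onorm_matrix_mult_le:
  fixes A B :: "real^2^2"
  shows "onorm ((*v) (A ** B)) \<le> onorm ((*v) A) * onorm ((*v) B)"
  using onorm_compose[OF matrix_vector_mul_bounded_linear[of A] matrix_vector_mul_bounded_linear[of B]]
  by (simp add: o_def matrix_vector_mul_assoc)

lemma column_norm_le_onorm:
  fixes A :: "real^2^2"
  shows "(A $ 1 $ j)\<^sup>2 + (A $ 2 $ j)\<^sup>2 \<le> (onorm ((*v) A))\<^sup>2"
proof -
  have "norm (A *v axis j 1) \<le> onorm ((*v) A) * norm (axis j (1::real))"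
    by (rule onorm) (rule matrix_vector_mul_bounded_linear)
  then have "norm (column j A) \<le> onorm ((*v) A)" by (simp add: matrix_vector_mult_basis)
  then have "(norm (column j A))\<^sup>2 \<le> (onorm ((*v) A))\<^sup>2" by (rule power_mono) simp
  moreover have "(norm (column j A))\<^sup>2 = (A $ 1 $ j)\<^sup>2 + (A $ 2 $ j)\<^sup>2"
    by (simp add: norm_vec_def L2_set_def sum_2 column_def)
  ultimately show ?thesis by simp
qed

text \<open>Lagrange's identity bounds the squared determinant by the product of the squared column
  norms. As a consequence the logarithms of the norms of the iterates are continuous and
  nonnegative.\<close>

lemma onorm_ge_1_of_det_1:
  fixes A :: "real^2^2"
  assumes "det A = 1"
  shows "1 \<le> onorm ((*v) A)"
proof -
  define N where "N = onorm ((*v) A)"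
  have "N \<ge> 0" unfolding N_def by (rule onorm_pos_le) (rule matrix_vector_mul_bounded_linear)
  have "1 = (A$1$1 * A$2$2 - A$1$2 * A$2$1)\<^sup>2" using assms by (simp add: det_2)
  also have "\<dots> \<le> ((A$1$1)\<^sup>2 + (A$2$1)\<^sup>2) * ((A$1$2)\<^sup>2 + (A$2$2)\<^sup>2)"
    using zero_le_power2[of "A$1$1 * A$1$2 + A$2$1 * A$2$2"]
    by (simp add: power2_eq_square algebra_simps)
  also have "\<dots> \<le> N\<^sup>2 * N\<^sup>2"
    unfolding N_def by (intro mult_mono column_norm_le_onorm) auto
  also have "\<dots> = N ^ 4" by (simp add: power2_eq_square power4_eq_xxxx)
  finally have "1 \<le> N ^ 4" .
  show ?thesis
  proof (rule ccontr)
    assume "\<not> ?thesis"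
    then have "N < 1" by (simp add: N_def)
    then have "N ^ 4 < 1" using \<open>N \<ge> 0\<close> power_strict_mono[of N 1 4] by simp
    with \<open>1 \<le> N ^ 4\<close> show False by simp
  qed
qed

text \<open>The operator norm is Lipschitz with respect to the sum of the absolute values of the
  entries.\<close>

lemma continuous_on_onorm_matrix:
  fixes M :: "real \<Rightarrow> real^2^2"
  assumes "\<And>i j. continuous_on UNIV (\<lambda>x. M x $ i $ j)"
  shows "continuous_on UNIV (\<lambda>x. onorm ((*v) (M x)))"
proof -
  have lin: "bounded_linear ((*v) A)" for A :: "real^2^2" by (rule matrix_vector_mul_bounded_linear)
  have diff: "onorm ((*v) A) \<le> onorm ((*v) B) + onorm ((*v) (A - B))" for A B :: "real^2^2"
    using onorm_triangle[OF lin[of B] lin[of "A - B"]] by (simp flip: matrix_vector_mult_add_rdistrib)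
  have sum: "\<bar>onorm ((*v) A) - onorm ((*v) B)\<bar> \<le> (\<Sum>i\<in>UNIV. \<Sum>j\<in>UNIV. \<bar>A$i$j - B$i$j\<bar>)" for A B :: "real^2^2"
  proof -
    have "onorm ((*v) (A - B)) \<le> (\<Sum>i\<in>UNIV. \<Sum>j\<in>UNIV. \<bar>A$i$j - B$i$j\<bar>)"
      "onorm ((*v) (B - A)) \<le> (\<Sum>i\<in>UNIV. \<Sum>j\<in>UNIV. \<bar>A$i$j - B$i$j\<bar>)"
      using onorm_le_matrix_component_sum[of "A - B"] onorm_le_matrix_component_sum[of "B - A"]
      by (simp_all add: abs_minus_commute)
    then show ?thesis using diff[of A B] diff[of B A] by linarith
  qed
  have "isCont (\<lambda>x. onorm ((*v) (M x))) a" for a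
  proof -
    have "((\<lambda>x. M x $ i $ j) \<longlongrightarrow> M a $ i $ j) (at a)" for i j
      using assms[of i j] by (simp add: continuous_on_def)
    then have "((\<lambda>x. \<Sum>i\<in>UNIV. \<Sum>j\<in>UNIV. \<bar>M x$i$j - M a$i$j\<bar>) \<longlongrightarrow> (\<Sum>i\<in>UNIV. \<Sum>j\<in>UNIV. \<bar>M a$i$j - M a$i$j\<bar>)) (at a)"
      by (intro tendsto_sum tendsto_rabs tendsto_diff tendsto_const)
    then have "((\<lambda>x. \<Sum>i\<in>UNIV. \<Sum>j\<in>UNIV. \<bar>M x$i$j - M a$i$j\<bar>) \<longlongrightarrow> 0) (at a)" by simp
    then have "((\<lambda>x. onorm ((*v) (M x)) - onorm ((*v) (M a))) \<longlongrightarrow> 0) (at a)"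
      by (rule Lim_null_comparison[rotated]) (simp add: sum)
    then show ?thesis unfolding isCont_def by (simp add: LIM_zero_iff)
  qed
  then show ?thesis by (simp add: continuous_at_imp_continuous_on)
qed

lemma schroedinger_matrix_mult_nth:
  "(schroedinger_matrix f lam E x ** B) $ 1 $ j = (E - lam * f x) * B $ 1 $ j - B $ 2 $ j"
  "(schroedinger_matrix f lam E x ** B) $ 2 $ j = B $ 1 $ j"
  by (simp_all add: schroedinger_matrix_def matrix_matrix_mult_def sum_2)

text \<open>The matrix is a rotation by a quarter turn plus a single entry
  \<open>E - lam * f x\<close> in the upper left corner.\<close>

lemma onorm_schroedinger_matrix_le:
  "onorm ((*v) (schroedinger_matrix f lam E x)) \<le> \<bar>E - lam * f x\<bar> + 1"
proof (rule onorm_le)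
  fix w :: "real^2"
  define v where "v = E - lam * f x"
  have "schroedinger_matrix f lam E x *v w = (v * w $ 1) *\<^sub>R axis 1 1 + vector [- w $ 2, w $ 1]"
    unfolding vec_eq_iff forall_2
    by (simp add: schroedinger_matrix_def matrix_vector_mult_def sum_2 v_def axis_def)
  then have "norm (schroedinger_matrix f lam E x *v w) \<le> \<bar>v * w $ 1\<bar> + norm (vector [- w $ 2, w $ 1] :: real^2)"
    using norm_triangle_ineq[of "(v * w $ 1) *\<^sub>R axis 1 (1::real)" "vector [- w $ 2, w $ 1] :: real^2"] by simp
  also have "norm (vector [- w $ 2, w $ 1] :: real^2) = norm w"
    by (simp add: norm_vec_def L2_set_def sum_2 add.commute)
  also have "\<bar>v * w $ 1\<bar> \<le> \<bar>v\<bar> * norm w"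
    using component_le_norm_cart[of w 1] by (simp add: abs_mult mult_left_mono)
  finally show "norm (schroedinger_matrix f lam E x *v w) \<le> (\<bar>E - lam * f x\<bar> + 1) * norm w"
    by (simp add: v_def algebra_simps)
qed

locale schroedinger_cocycle =
  fixes f :: "real \<Rightarrow> real" and \<alpha> lam E :: real
  assumes cont: "continuous_on UNIV f" and per: "\<And>x. f (x + 1) = f x"
begin

abbreviation A where "A \<equiv> schroedinger_matrix f lam E"
abbreviation iter where "iter \<equiv> cocycle_iterate \<alpha> A"

definition log_norm :: "nat \<Rightarrow> real" where
  "log_norm n = (LINT x:{0..1}|lborel. ln (onorm ((*v) (iter n x))))"

lemma iter_add: "iter (m + n) x = iter m (x + real n * \<alpha>) ** iter n x"
  by (induction m) (simp_all add: matrix_mul_assoc algebra_simps)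

lemma iter_periodic: "iter n (x + 1) = iter n x"
proof (induction n)
  case (Suc n)
  have "A (x + real n * \<alpha> + 1) = A (x + real n * \<alpha>)" unfolding schroedinger_matrix_def by (simp only: per)
  then show ?case using Suc by (simp add: algebra_simps)
qed simp

lemma det_iter: "det (iter n x) = 1"
proof -
  have "det (A y) = 1" for y by (simp add: det_2 schroedinger_matrix_def)
  then show ?thesis by (induction n) (simp_all add: det_mul)
qed

lemma onorm_iter_ge_1: "1 \<le> onorm ((*v) (iter n x))"
  by (rule onorm_ge_1_of_det_1[OF det_iter])

lemma continuous_on_potential: "continuous_on UNIV (\<lambda>x. f (x + c))"
  by (rule continuous_on_compose2[OF cont]) (auto intro!: continuous_intros)

lemma continuous_on_iter: "continuous_on UNIV (\<lambda>x. iter n x $ i $ j)"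
proof (induction n arbitrary: i j)
  case (Suc n)
  consider "i = 1" | "i = 2" using exhaust_2 by blast
  then show ?case
    by cases (simp_all add: schroedinger_matrix_mult_nth Suc continuous_on_potential continuous_intros)
qed simp

lemma continuous_on_ln_onorm: "continuous_on UNIV (\<lambda>x. ln (onorm ((*v) (iter n x))))"
proof (rule continuous_on_ln[OF continuous_on_onorm_matrix[OF continuous_on_iter]], rule ballI)
  fix x show "onorm ((*v) (iter n x)) \<noteq> 0" using onorm_iter_ge_1[of n x] by simp
qed

text \<open>The cocycle identity \<open>iter_add\<close> makes the norms submultiplicative up to a
  shift of the base point, and the integral over a period does not see the shift.\<close>

lemma log_norm_add: "log_norm (m + n) \<le> log_norm m + log_norm n"
proof -
  let ?g = "\<lambda>n x. ln (onorm ((*v) (iter n x)))"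
  have cont_shift: "continuous_on UNIV (\<lambda>x. ?g m (x + real n * \<alpha>))"
    by (rule continuous_on_compose2[OF continuous_on_ln_onorm]) (auto intro!: continuous_intros)
  have "log_norm (m + n) \<le> (LINT x:{0..1}|lborel. ?g m (x + real n * \<alpha>) + ?g n x)"
    unfolding log_norm_def
  proof (rule set_integral_mono)
    fix x
    have "?g (m + n) x \<le> ln (onorm ((*v) (iter m (x + real n * \<alpha>))) * onorm ((*v) (iter n x)))"
      unfolding iter_add using onorm_iter_ge_1[of "m + n" x] onorm_matrix_mult_le
      by (intro ln_mono) (auto simp: iter_add intro: less_le_trans[OF zero_less_one])
    also have "\<dots> = ?g m (x + real n * \<alpha>) + ?g n x"
      using onorm_iter_ge_1[of m "x + real n * \<alpha>"] onorm_iter_ge_1[of n x] by (intro ln_mult_pos) auto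
    finally show "?g (m + n) x \<le> ?g m (x + real n * \<alpha>) + ?g n x" .
  qed (intro set_integrable_unit_interval continuous_on_add continuous_on_ln_onorm cont_shift)+
  also have "\<dots> = (LINT x:{0..1}|lborel. ?g m (x + real n * \<alpha>)) + log_norm n"
    unfolding log_norm_def
    by (intro set_integral_add set_integrable_unit_interval continuous_on_ln_onorm cont_shift)
  also have "(LINT x:{0..1}|lborel. ?g m (x + real n * \<alpha>)) = log_norm m"
    unfolding log_norm_def by (rule integral_periodic_shift[OF continuous_on_ln_onorm]) (simp add: iter_periodic)
  finally show ?thesis .
qed

lemma log_norm_nonneg: "log_norm n \<ge> 0"
  unfolding log_norm_def set_lebesgue_integral_def
  using onorm_iter_ge_1 by (intro Bochner_Integration.integral_nonneg) simp

text \<open>\<open>lim\<close> carries information only for a convergent sequence; Fekete's lemma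
  supplies the convergence.\<close>

lemma lyapunov_exponent_LIMSEQ:
  "(\<lambda>n. log_norm n / real n) \<longlonglongrightarrow> lyapunov_exponent \<alpha> A"
  using subadditive_convergent[of log_norm, OF log_norm_add log_norm_nonneg]
  unfolding lyapunov_exponent_def log_norm_def by (simp add: convergent_LIMSEQ_iff)

lemma lyapunov_exponent_le:
  "lyapunov_exponent \<alpha> A \<le> (LINT x:{0..1}|lborel. ln (\<bar>E - lam * f x\<bar> + 1))"
proof -
  have one: "log_norm 1 \<le> (LINT x:{0..1}|lborel. ln (\<bar>E - lam * f x\<bar> + 1))"
    unfolding log_norm_def
  proof (rule set_integral_mono)
    show "set_integrable lborel {0..1} (\<lambda>x. ln (\<bar>E - lam * f x\<bar> + 1))"
      by (rule set_integrable_unit_interval) (auto intro!: continuous_intros cont simp: add_nonneg_eq_0_iff)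
    fix x
    show "ln (onorm ((*v) (iter 1 x))) \<le> ln (\<bar>E - lam * f x\<bar> + 1)"
      using onorm_iter_ge_1[of 1 x] onorm_schroedinger_matrix_le[of f lam E x] by (intro ln_mono) auto
  qed (intro set_integrable_unit_interval continuous_on_ln_onorm)
  have "log_norm n \<le> real n * log_norm 1" if "n \<ge> 1" for n
    using that
  proof (induction n rule: dec_induct)
    case (step n)
    then show ?case using log_norm_add[of n 1] by (simp add: algebra_simps)
  qed simp
  then have "log_norm n / real n \<le> (LINT x:{0..1}|lborel. ln (\<bar>E - lam * f x\<bar> + 1))" if "n \<ge> 1" for n
    using that one by (simp add: divide_le_eq mult.commute) (smt (verit) mult_left_mono of_nat_0_le_iff)
  then show ?thesis by (intro LIMSEQ_le_const2[OF lyapunov_exponent_LIMSEQ]) blast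
qed

lemma lyapunov_exponent_ge:
  assumes "\<And>n. n \<ge> 1 \<Longrightarrow> real n * V - c \<le> log_norm n"
  shows "V \<le> lyapunov_exponent \<alpha> A"
proof (rule LIMSEQ_le[OF _ lyapunov_exponent_LIMSEQ])
  have "(\<lambda>n. V - c / real n) \<longlonglongrightarrow> V - 0"
    by (intro tendsto_diff tendsto_const lim_const_over_n)
  then show "(\<lambda>n. V - c / real n) \<longlonglongrightarrow> V" by simp
  have "V - c / real n \<le> log_norm n / real n" if "n \<ge> 1" for n
  proof -
    have "(real n * V - c) / real n \<le> log_norm n / real n"
      using assms[OF that] by (intro divide_right_mono) auto
    then show ?thesis using that by (simp add: diff_divide_distrib)
  qed
  then show "\<exists>n0. \<forall>n\<ge>n0. V - c / real n \<le> log_norm n / real n" by blast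
qed

end

section \<open>Lower bounds from horizontal lines\<close>

lemma Complex_add_of_real: "Complex x y + of_real c = Complex (x + c) y"
  by (simp add: complex_eq_iff)

lemma continuous_on_horizontal_line:
  assumes "g holomorphic_on {z. \<bar>Im z\<bar> < h}" "\<bar>y\<bar> < h"
  shows "continuous_on UNIV (\<lambda>x. g (Complex x y))"
  by (rule continuous_on_compose2[OF holomorphic_on_imp_continuous_on[OF assms(1)]])
    (use assms(2) in \<open>auto simp: Complex_eq intro!: continuous_intros\<close>)

text \<open>The holomorphic extension of the upper left entry of the \<open>n\<close>-step transfer matrix.\<close>

fun transfer_poly :: "real \<Rightarrow> (complex \<Rightarrow> complex) \<Rightarrow> nat \<Rightarrow> complex \<Rightarrow> complex" where
  "transfer_poly \<alpha> v 0 z = 1"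
| "transfer_poly \<alpha> v (Suc 0) z = v z"
| "transfer_poly \<alpha> v (Suc (Suc n)) z =
    v (z + of_real (real (Suc n) * \<alpha>)) * transfer_poly \<alpha> v (Suc n) z - transfer_poly \<alpha> v n z"

lemma abs_ln_norm_one_minus_le:
  fixes w :: complex
  assumes "cmod w \<le> s" "s \<le> 1 / 2"
  shows "\<bar>ln (cmod (1 - w))\<bar> \<le> 2 * s"
proof -
  have "0 \<le> s" using norm_ge_zero[of w] assms by linarith
  have "1 - s \<le> cmod (1 - w)" using norm_triangle_ineq2[of 1 w] assms by simp
  moreover have "cmod (1 - w) \<le> 1 + s" using norm_triangle_ineq4[of 1 w] assms by simp
  ultimately have "ln (1 - s) \<le> ln (cmod (1 - w))" "ln (cmod (1 - w)) \<le> ln (1 + s)"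
    using assms by (intro ln_mono; linarith)+
  moreover have "ln (1 + s) \<le> s" by (rule ln_add_one_self_le_self[OF \<open>0 \<le> s\<close>])
  moreover have "- s - 2 * s\<^sup>2 \<le> ln (1 - s)" using ln_one_minus_pos_lower_bound[of s] \<open>0 \<le> s\<close> assms by simp
  moreover have "2 * s\<^sup>2 \<le> s" using mult_left_mono[OF assms(2) \<open>0 \<le> s\<close>] by (simp add: power2_eq_square)
  ultimately show ?thesis by linarith
qed

text \<open>The two claims are proved together: if |P_n| \<le> |P_(n+1)| and the coefficient has
  modulus at least 2, the subtracted term removes at most one of the two copies of
  |P_(n+1)|.\<close>

lemma transfer_poly_growth:
  assumes "D \<ge> 2" and v: "\<And>x. D \<le> cmod (v (Complex x y))"
  shows "1 \<le> cmod (transfer_poly \<alpha> v n (Complex x y))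
    \<and> cmod (transfer_poly \<alpha> v n (Complex x y)) \<le> cmod (transfer_poly \<alpha> v (Suc n) (Complex x y))"
proof (induction n)
  case 0
  then show ?case using v[of x] \<open>D \<ge> 2\<close> by simp
next
  case (Suc n)
  define P where "P = (\<lambda>n. transfer_poly \<alpha> v n (Complex x y))"
  define w where "w = v (Complex (x + real (Suc n) * \<alpha>) y)"
  have IH: "1 \<le> cmod (P n)" "cmod (P n) \<le> cmod (P (Suc n))" using Suc by (auto simp: P_def)
  have "P (Suc (Suc n)) = w * P (Suc n) - P n"
    by (simp only: P_def w_def transfer_poly.simps(3) Complex_add_of_real)
  moreover have "2 * cmod (P (Suc n)) \<le> cmod (w * P (Suc n))"
    using v[of "x + real (Suc n) * \<alpha>"] \<open>D \<ge> 2\<close> by (simp add: norm_mult w_def mult_right_mono)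
  ultimately have "cmod (P (Suc n)) \<le> cmod (P (Suc (Suc n)))"
    using norm_triangle_ineq2[of "w * P (Suc n)" "P n"] IH by simp
  then show ?case using IH unfolding P_def by simp
qed

text \<open>Write the recursion as P_(n+2) = w P_(n+1) (1 - s) with s = P_n / (w P_(n+1)). Growth of
  the moduli gives |s| \<le> 1/D, so each step deviates from \<open>ln (cmod w)\<close> by at most
  2/D.\<close>

lemma ln_transfer_poly:
  assumes "D \<ge> 2" and v: "\<And>x. D \<le> cmod (v (Complex x y))"
  shows "\<bar>ln (cmod (transfer_poly \<alpha> v n (Complex x y)))
      - (\<Sum>k<n. ln (cmod (v (Complex (x + real k * \<alpha>) y))))\<bar> \<le> real n * (2 / D)"
proof (induction n rule: induct_nat_012)
  case 1
  then show ?case using \<open>D \<ge> 2\<close> by simp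
next
  case (ge2 n)
  define P where "P = (\<lambda>n. transfer_poly \<alpha> v n (Complex x y))"
  define w where "w = v (Complex (x + real (Suc n) * \<alpha>) y)"
  have growth: "1 \<le> cmod (P n)" "cmod (P n) \<le> cmod (P (Suc n))"
    using transfer_poly_growth[of D v y, OF \<open>D \<ge> 2\<close> v] by (auto simp: P_def)
  have "D \<le> cmod w" unfolding w_def by (rule v)
  have ne: "w \<noteq> 0" "P (Suc n) \<noteq> 0" using growth \<open>D \<le> cmod w\<close> \<open>D \<ge> 2\<close> by auto
  define s where "s = P n / (w * P (Suc n))"
  have "cmod s = (cmod (P n) / cmod (P (Suc n))) / cmod w" by (simp add: s_def norm_divide norm_mult)
  also have "\<dots> \<le> 1 / cmod w"
    using growth by (intro divide_right_mono) (auto simp: divide_le_eq)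
  also have "\<dots> \<le> 1 / D" using \<open>D \<le> cmod w\<close> \<open>D \<ge> 2\<close> by (simp add: frac_le)
  finally have s: "cmod s \<le> 1 / D" "1 / D \<le> 1 / 2" using \<open>D \<ge> 2\<close> by (auto simp: field_simps)
  have "s \<noteq> 1" using s by auto
  have "P (Suc (Suc n)) = w * P (Suc n) - P n"
    by (simp only: P_def w_def transfer_poly.simps(3) Complex_add_of_real)
  also have "\<dots> = w * P (Suc n) * (1 - s)" using ne by (simp add: s_def field_simps)
  finally have "ln (cmod (P (Suc (Suc n)))) = ln (cmod w) + ln (cmod (P (Suc n))) + ln (cmod (1 - s))"
    using ne \<open>s \<noteq> 1\<close> by (simp add: norm_mult ln_mult)
  moreover have "\<bar>ln (cmod (1 - s))\<bar> \<le> 2 * (1 / D)" using s by (rule abs_ln_norm_one_minus_le)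
  moreover have "(\<Sum>k<Suc (Suc n). ln (cmod (v (Complex (x + real k * \<alpha>) y))))
    = (\<Sum>k<Suc n. ln (cmod (v (Complex (x + real k * \<alpha>) y)))) + ln (cmod w)"
    by (simp only: sum.lessThan_Suc w_def)
  moreover have "real (Suc (Suc n)) * (2 / D) = real (Suc n) * (2 / D) + 2 * (1 / D)"
    by (simp add: add_divide_distrib)
  ultimately show ?case using ge2(2) unfolding P_def by linarith
qed simp

locale analytic_schroedinger_cocycle = schroedinger_cocycle +
  fixes v :: "complex \<Rightarrow> complex" and h :: real
  assumes v_holomorphic: "v holomorphic_on {z. \<bar>Im z\<bar> < h}"
    and v_periodic: "\<And>z. \<bar>Im z\<bar> < h \<Longrightarrow> v (z + 1) = v z"
    and v_real: "\<And>x. v (of_real x) = of_real (E - lam * f x)"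
begin

abbreviation P where "P \<equiv> transfer_poly \<alpha> v"

text \<open>The lower left entry of an iterate is the upper left entry of its predecessor, which
  turns the matrix recursion into the three-term one.\<close>

lemma P_of_real: "P n (of_real x) = of_real (iter n x $ 1 $ 1)"
proof (induction n rule: induct_nat_012)
  case (ge2 n)
  have "iter (Suc (Suc n)) x $ 1 $ 1
    = (E - lam * f (x + real (Suc n) * \<alpha>)) * iter (Suc n) x $ 1 $ 1 - iter n x $ 1 $ 1"
    by (simp add: schroedinger_matrix_mult_nth)
  moreover have "v (of_real x + of_real (real (Suc n) * \<alpha>)) = of_real (E - lam * f (x + real (Suc n) * \<alpha>))"
    using v_real[of "x + real (Suc n) * \<alpha>"] by (simp only: of_real_add)
  ultimately show ?case unfolding transfer_poly.simps(3) by (simp only: ge2 of_real_mult of_real_diff)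
qed (simp_all add: schroedinger_matrix_mult_nth mat_def v_real)

lemma P_holomorphic: "P n holomorphic_on {z. \<bar>Im z\<bar> < h}"
proof (induction n rule: induct_nat_012)
  case (ge2 n)
  have "(v \<circ> (\<lambda>z. z + of_real (real (Suc n) * \<alpha>))) holomorphic_on {z. \<bar>Im z\<bar> < h}"
    by (rule holomorphic_on_compose_gen[OF _ v_holomorphic]) (auto intro!: holomorphic_intros)
  then have "(\<lambda>z. v (z + of_real (real (Suc n) * \<alpha>)) * P (Suc n) z - P n z) holomorphic_on {z. \<bar>Im z\<bar> < h}"
    using ge2 by (intro holomorphic_intros) (simp_all add: o_def)
  then show ?case by simp
next
  case 1
  then show ?case using v_holomorphic by (simp cong: holomorphic_cong)
qed simp

lemma P_periodic:
  assumes "\<bar>Im z\<bar> < h"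
  shows "P n (z + 1) = P n z"
proof (induction n rule: induct_nat_012)
  case (ge2 n)
  have "v (z + 1 + of_real (real (Suc n) * \<alpha>)) = v (z + of_real (real (Suc n) * \<alpha>))"
    using v_periodic[of "z + of_real (real (Suc n) * \<alpha>)"] assms by (simp add: add.assoc add.commute add.left_commute)
  then show ?case using ge2 by simp
qed (simp_all add: assms v_periodic)

definition line_mean :: "real \<Rightarrow> real" where
  "line_mean y = (LINT x:{0..1}|lborel. ln (cmod (v (Complex x y))))"

text \<open>The regularization 1 is fixed, independent of \<open>n\<close>: it makes the mean finite
  across zeros of \<open>P n\<close> and costs at most \<open>ln 2 / 2\<close> where
  \<open>P n\<close> has modulus at least 1, which disappears after division by
  \<open>n\<close>.\<close>

definition poly_mean :: "nat \<Rightarrow> real \<Rightarrow> real" where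
  "poly_mean n y = integral {0..1} (\<lambda>x. ln ((cmod (P n (Complex x y)))\<^sup>2 + 1) / 2)"

lemma continuous_on_ln_P:
  assumes "\<bar>y\<bar> < h"
  shows "continuous_on UNIV (\<lambda>x. ln ((cmod (P n (Complex x y)))\<^sup>2 + 1) / 2)"
proof -
  have "t\<^sup>2 + 1 \<noteq> 0" for t :: real using zero_le_power2[of t] by linarith
  then show ?thesis
    by (intro continuous_intros continuous_on_horizontal_line[OF P_holomorphic assms]) auto
qed

lemma poly_mean_eq:
  assumes "\<bar>y\<bar> < h"
  shows "poly_mean n y = (LINT x:{0..1}|lborel. ln ((cmod (P n (Complex x y)))\<^sup>2 + 1) / 2)"
  unfolding poly_mean_def
  by (intro set_borel_integral_eq_integral(2)[symmetric] set_integrable_unit_interval continuous_on_ln_P assms)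

lemma convex_on_poly_mean: "convex_on {-h<..<h} (poly_mean n)"
  unfolding poly_mean_def by (rule convex_on_log_mean[OF P_holomorphic P_periodic]) auto

text \<open>An entry is bounded by the norm, and the norm is at least 1, so the regularized square
  is at most twice the squared norm.\<close>

lemma poly_mean_0_le:
  assumes "h > 0"
  shows "poly_mean n 0 \<le> log_norm n + ln 2 / 2"
proof -
  have "\<bar>0\<bar> < h" using assms by simp
  have "poly_mean n 0 \<le> (LINT x:{0..1}|lborel. ln (onorm ((*v) (iter n x))) + ln 2 / 2)"
    unfolding poly_mean_eq[OF \<open>\<bar>0\<bar> < h\<close>]
  proof (rule set_integral_mono)
    fix x
    define N where "N = onorm ((*v) (iter n x))"
    have "1 \<le> N" unfolding N_def by (rule onorm_iter_ge_1)
    have "(iter n x $ 1 $ 1)\<^sup>2 \<le> N\<^sup>2"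
      using column_norm_le_onorm[of "iter n x" 1] zero_le_power2[of "iter n x $ 2 $ 1"]
      unfolding N_def by linarith
    moreover have "P n (Complex x 0) = of_real (iter n x $ 1 $ 1)"
      using P_of_real[of n x] by (simp add: complex_of_real_def)
    moreover have "1 \<le> N\<^sup>2" using \<open>1 \<le> N\<close> by (simp add: one_le_power)
    ultimately have "(cmod (P n (Complex x 0)))\<^sup>2 + 1 \<le> N\<^sup>2 * 2" by simp
    then have "ln ((cmod (P n (Complex x 0)))\<^sup>2 + 1) \<le> ln (N\<^sup>2 * 2)"
      by (intro ln_mono) (auto intro: add_nonneg_pos)
    also have "\<dots> = 2 * ln N + ln 2" using \<open>1 \<le> N\<close> by (simp add: ln_mult_pos ln_realpow)
    finally show "ln ((cmod (P n (Complex x 0)))\<^sup>2 + 1) / 2 \<le> ln (onorm ((*v) (iter n x))) + ln 2 / 2"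
      by (simp add: N_def)
  qed (intro set_integrable_unit_interval continuous_on_ln_P continuous_on_add continuous_on_ln_onorm
      continuous_on_const, (simp add: assms)?)+
  also have "\<dots> = log_norm n + ln 2 / 2"
    unfolding log_norm_def
    by (subst set_integral_add(2))
      (auto intro!: set_integrable_unit_interval continuous_on_ln_onorm simp: set_lebesgue_integral_def)
  finally show ?thesis .
qed

text \<open>By invariance under shifts each of the \<open>n\<close> terms of the orbit sum in
  \<open>ln_transfer_poly\<close> integrates to the same line mean.\<close>

lemma poly_mean_line:
  assumes "\<bar>y\<bar> < h" "D \<ge> 2" and v: "\<And>x. D \<le> cmod (v (Complex x y))"
  shows "real n * (line_mean y - 2 / D) \<le> poly_mean n y"
    and "poly_mean n y \<le> real n * (line_mean y + 2 / D) + ln 2 / 2"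
proof -
  let ?l = "\<lambda>x. ln (cmod (v (Complex x y)))"
  let ?s = "\<lambda>x. \<Sum>k<n. ?l (x + real k * \<alpha>)"
  have cont_l: "continuous_on UNIV ?l"
  proof (intro continuous_on_ln continuous_on_norm continuous_on_horizontal_line[OF v_holomorphic assms(1)] ballI)
    fix x show "cmod (v (Complex x y)) \<noteq> 0" using v[of x] \<open>D \<ge> 2\<close> by linarith
  qed
  have cont_k: "continuous_on UNIV (\<lambda>x. ?l (x + c))" for c
    by (rule continuous_on_compose2[OF cont_l]) (auto intro!: continuous_intros)
  have per_l: "?l (x + 1) = ?l x" for x
    using v_periodic[of "Complex x y"] assms(1) Complex_add_of_real[of x y 1] by simp
  have sum: "(LINT x:{0..1}|lborel. ?s x) = real n * line_mean y"
  proof -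
    have "(LINT x:{0..1}|lborel. ?s x) = (\<Sum>k<n. LINT x:{0..1}|lborel. ?l (x + real k * \<alpha>))"
      using set_integrable_unit_interval[OF cont_k]
      unfolding set_lebesgue_integral_def set_integrable_def scaleR_sum_right
      by (intro Bochner_Integration.integral_sum)
    also have "\<dots> = (\<Sum>k<n. line_mean y)"
      unfolding line_mean_def by (intro sum.cong refl integral_periodic_shift[OF cont_l per_l])
    finally show ?thesis by simp
  qed
  have int_s: "set_integrable lborel {0..1} (\<lambda>x. ?s x + c)" for c
    by (intro set_integrable_unit_interval continuous_on_add continuous_on_sum cont_k continuous_on_const)
  have int_sc: "(LINT x:{0..1}|lborel. ?s x + c) = real n * line_mean y + c" for c
    unfolding sum[symmetric] using int_s[of 0]
    by (subst set_integral_add(2))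
      (auto intro!: set_integrable_unit_interval simp: set_lebesgue_integral_def)
  have int_P: "set_integrable lborel {0..1} (\<lambda>x. ln ((cmod (P n (Complex x y)))\<^sup>2 + 1) / 2)"
    by (intro set_integrable_unit_interval continuous_on_ln_P assms(1))
  have "real n * line_mean y + - (real n * (2 / D)) \<le> poly_mean n y"
    unfolding poly_mean_eq[OF assms(1)] int_sc[symmetric]
  proof (rule set_integral_mono[OF int_s int_P])
    fix x
    let ?a = "cmod (P n (Complex x y))"
    have "1 \<le> ?a" using transfer_poly_growth[of D v y, OF assms(2) v] by blast
    have "?s x + - (real n * (2 / D)) \<le> ln ?a"
      using ln_transfer_poly[of D v y \<alpha> n x, OF assms(2) v] by linarith
    also have "ln ?a = ln (?a\<^sup>2) / 2" using \<open>1 \<le> ?a\<close> by (simp add: ln_realpow)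
    also have "\<dots> \<le> ln (?a\<^sup>2 + 1) / 2" using \<open>1 \<le> ?a\<close> by (intro divide_right_mono ln_mono) auto
    finally show "?s x + - (real n * (2 / D)) \<le> ln (?a\<^sup>2 + 1) / 2" .
  qed
  then show "real n * (line_mean y - 2 / D) \<le> poly_mean n y" by (simp add: algebra_simps)
  have "poly_mean n y \<le> real n * line_mean y + (real n * (2 / D) + ln 2 / 2)"
    unfolding poly_mean_eq[OF assms(1)] int_sc[symmetric]
  proof (rule set_integral_mono[OF int_P int_s])
    fix x
    let ?a = "cmod (P n (Complex x y))"
    have "1 \<le> ?a" using transfer_poly_growth[of D v y, OF assms(2) v] by blast
    then have "1 \<le> ?a\<^sup>2" by (simp add: one_le_power)
    then have "ln (?a\<^sup>2 + 1) / 2 \<le> ln (?a\<^sup>2 * 2) / 2"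
      by (intro divide_right_mono ln_mono) auto
    also have "\<dots> = ln ?a + ln 2 / 2"
    proof -
      have "ln (?a\<^sup>2 * 2) = ln (?a\<^sup>2) + ln 2" using \<open>1 \<le> ?a\<^sup>2\<close> by (intro ln_mult_pos) linarith+
      then show ?thesis by (simp add: ln_realpow)
    qed
    also have "ln ?a \<le> ?s x + real n * (2 / D)"
      using ln_transfer_poly[of D v y \<alpha> n x, OF assms(2) v] by linarith
    finally show "ln (?a\<^sup>2 + 1) / 2 \<le> ?s x + (real n * (2 / D) + ln 2 / 2)" by simp
  qed
  then show "poly_mean n y \<le> real n * (line_mean y + 2 / D) + ln 2 / 2" by (simp add: algebra_simps)
qed

text \<open>
  Convexity read backwards: large means at height \<open>y1\<close> and moderate ones at height \<open>y2\<close> force a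
  large mean on the real line, where no direct lower bound is available.
\<close>

lemma lyapunov_exponent_ge_line_means:
  assumes y: "0 < y1" "2 * y1 \<le> y2" "y2 < h" and "D \<ge> 2" "\<eta> \<ge> 0"
    and v1: "\<And>x. D \<le> cmod (v (Complex x y1))" and v2: "\<And>x. D \<le> cmod (v (Complex x y2))"
    and J: "J \<le> line_mean y1" "line_mean y2 \<le> J + \<eta>"
  shows "J - 6 / D - \<eta> \<le> lyapunov_exponent \<alpha> A"
proof (rule lyapunov_exponent_ge[where c = "ln 2"])
  fix n :: nat
  \<comment> \<open>The weight that writes \<open>y1\<close> as a convex combination of 0 and
    \<open>y2\<close>; the condition \<open>2 * y1 \<le> y2\<close> gives t \<le> 1/2, so dividing
    by 1 - t at the end costs at most a factor 2.\<close>
  define t where "t = y1 / y2"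
  have t: "0 < t" "t \<le> 1 / 2" "y1 = (1 - t) * 0 + t * y2" using y by (auto simp: t_def field_simps)
  have "real n * (J - 2 / D) \<le> poly_mean n y1"
    using poly_mean_line(1)[OF _ \<open>D \<ge> 2\<close> v1, of n] y J by (smt (verit) mult_left_mono of_nat_0_le_iff)
  also have "poly_mean n y1 \<le> (1 - t) * poly_mean n 0 + t * poly_mean n y2"
    using convex_onD[OF convex_on_poly_mean, of t 0 y2 n] t y by simp
  also have "\<dots> \<le> (1 - t) * (log_norm n + ln 2 / 2) + t * (real n * (J + \<eta> + 2 / D) + ln 2 / 2)"
  proof (intro add_mono mult_left_mono)
    show "poly_mean n 0 \<le> log_norm n + ln 2 / 2" using y by (intro poly_mean_0_le) auto
    have "real n * (line_mean y2 + 2 / D) \<le> real n * (J + \<eta> + 2 / D)"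
      using J by (intro mult_left_mono) auto
    then show "poly_mean n y2 \<le> real n * (J + \<eta> + 2 / D) + ln 2 / 2"
      using poly_mean_line(2)[OF _ \<open>D \<ge> 2\<close> v2, of n] y by simp
  qed (use t in auto)
  finally have *: "real n * (J - 2 / D)
      \<le> (1 - t) * (log_norm n + ln 2 / 2) + t * (real n * (J + \<eta> + 2 / D) + ln 2 / 2)" .
  define q where "q = 2 / D"
  have main: "(1 - t) * (real n * J) - real n * ((1 + t) * (2 / D) + t * \<eta>) - ln 2 / 2
      \<le> (1 - t) * log_norm n" using * unfolding q_def[symmetric] by (simp add: field_simps)
  have "(1 - t) * (real n * (J - 6 / D - \<eta>) - ln 2)
    \<le> (1 - t) * (real n * J) - real n * ((1 + t) * (2 / D) + t * \<eta>) - ln 2 / 2"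
  proof -
    \<comment> \<open>Both parts rest on t \<le> 1/2: the constant 6 comes from 2 + 2t \<le> 6 - 6t,
      and \<eta> is absorbed through t \<le> 1 - t.\<close>
    have "(1 + t) * (2 / D) + t * \<eta> \<le> (1 - t) * (6 / D) + (1 - t) * \<eta>"
    proof (rule add_mono)
      have "(1 + t) * (2 / D) = (2 + 2 * t) / D" "(1 - t) * (6 / D) = (6 - 6 * t) / D"
        by (simp_all add: algebra_simps)
      then show "(1 + t) * (2 / D) \<le> (1 - t) * (6 / D)"
        using t \<open>D \<ge> 2\<close> by (simp add: divide_right_mono)
      show "t * \<eta> \<le> (1 - t) * \<eta>" using t \<open>\<eta> \<ge> 0\<close> by (intro mult_right_mono) auto
    qed
    then have "real n * ((1 + t) * (2 / D) + t * \<eta>) \<le> real n * ((1 - t) * (6 / D) + (1 - t) * \<eta>)"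
      by (intro mult_left_mono) auto
    moreover have "ln 2 / 2 \<le> (1 - t) * ln (2::real)" using t mult_right_mono[of "1/2" "1 - t" "ln 2"] by simp
    ultimately show ?thesis by (simp add: algebra_simps)
  qed
  also note main
  finally show "real n * (J - 6 / D - \<eta>) - ln 2 \<le> log_norm n" using t by (simp add: mult_le_cancel_left)
qed

end

section \<open>Functions on the circle with an analytic extension\<close>

locale circle_extension =
  fixes f :: "real \<Rightarrow> real" and G :: "complex \<Rightarrow> complex" and h :: real
  assumes h: "h > 0" and nonconst: "\<not> f constant_on UNIV"
    and holG: "G holomorphic_on {z. \<bar>Im z\<bar> < h}"
    and G_periodic: "\<And>z. \<bar>Im z\<bar> < h \<Longrightarrow> G (z + 1) = G z"
    and G_real: "\<And>x. G (of_real x) = of_real (f x)"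
    and G_cnj: "\<And>z. G (cnj z) = cnj (G z)"

text \<open>
  Averaging \<open>F\<close> with its conjugate reflection gives an extension commuting with conjugation
  without appealing to the identity theorem.
\<close>

lemma ex_circle_extension:
  assumes "f \<in> analytic_circle_functions h" "h > 0" "\<not> f constant_on UNIV"
  obtains G where "circle_extension f G h"
proof -
  obtain F where F: "F analytic_on strip h" "\<And>z. z \<in> strip h \<Longrightarrow> F (z + 1) = F z"
    "\<And>x. F (of_real x) = of_real (f x)"
    using assms unfolding analytic_circle_functions_def by auto
  have sub: "{z. \<bar>Im z\<bar> < h} \<subseteq> strip h" by (auto simp: strip_def)
  have holF: "F holomorphic_on {z. \<bar>Im z\<bar> < h}"
    using analytic_imp_holomorphic[OF F(1)] sub by (rule holomorphic_on_subset)
  define G where "G = (\<lambda>z. (F z + cnj (F (cnj z))) / 2)"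
  show ?thesis
  proof (rule that[of G], rule circle_extension.intro[OF assms(2,3)])
    have "cnj ` {z. \<bar>Im z\<bar> < h} = {z. \<bar>Im z\<bar> < h}"
      unfolding image_cnj_conv_vimage_cnj by auto
    then have "cnj \<circ> F \<circ> cnj holomorphic_on {z. \<bar>Im z\<bar> < h}"
      using holF by (intro holomorphic_on_compose_cnj_cnj strip_open) simp
    then show "G holomorphic_on {z. \<bar>Im z\<bar> < h}"
      unfolding G_def using holF by (intro holomorphic_intros) (simp_all add: o_def)
    show "G (z + 1) = G z" if "\<bar>Im z\<bar> < h" for z
      using F(2)[of z] F(2)[of "cnj z"] that by (simp add: G_def strip_def)
    show "G (of_real x) = of_real (f x)" for x by (simp add: G_def F(3))
    show "G (cnj z) = cnj (G z)" for z by (simp add: G_def add.commute)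
  qed
qed

context circle_extension
begin

lemma G_Complex_0: "G (Complex x 0) = of_real (f x)"
  using G_real[of x] by (simp add: complex_of_real_def)

lemma f_periodic: "f (x + 1) = f x"
proof -
  have "complex_of_real (f (x + 1)) = of_real (f x)"
    using G_periodic[of "of_real x"] h by (simp flip: G_real)
  then show ?thesis by (simp only: of_real_eq_iff)
qed

lemma f_continuous: "continuous_on UNIV f"
proof -
  have "continuous_on UNIV (\<lambda>x. Re (G (Complex x 0)))"
    by (intro continuous_on_Re continuous_on_horizontal_line[OF holG]) (simp add: h)
  then show ?thesis by (simp add: G_Complex_0)
qed

lemma G_nonconstant: "\<not> G constant_on {z. \<bar>Im z\<bar> < h}"
proof
  assume "G constant_on {z. \<bar>Im z\<bar> < h}"
  then obtain c where c: "\<And>z. \<bar>Im z\<bar> < h \<Longrightarrow> G z = c" unfolding constant_on_def by auto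
  have "of_real (f x) = c" for x using c[of "of_real x"] h by (simp add: G_real)
  then have "f x = Re c" for x by (metis Re_complex_of_real)
  then have "f constant_on UNIV" unfolding constant_on_def by blast
  with nonconst show False by contradiction
qed

lemma G_frac: "\<bar>y\<bar> < h \<Longrightarrow> G (Complex x y) = G (Complex (frac x) y)"
proof -
  assume y: "\<bar>y\<bar> < h"
  define g where "g = (\<lambda>x. G (Complex x y))"
  have "g (x + 1) = g x" for x
    unfolding g_def using G_periodic[of "Complex x y"] y Complex_add_of_real[of x y 1] by simp
  from periodic_shift_int[of g, OF this, of "frac x" "\<lfloor>x\<rfloor>"] show ?thesis
    by (simp add: g_def frac_def)
qed

lemma sublevel_regularity:
  obtains r n C where "0 < r" "r < h" "r \<le> 1" "n > 0" "C > 0"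
    "\<And>e \<delta>. 0 < \<delta> \<Longrightarrow> \<delta> \<le> 1 \<Longrightarrow> diameter_cover n (C * \<delta> powr (1 / real n))
      {z. Re z \<in> {0..1} \<and> \<bar>Im z\<bar> < r \<and> cmod (e - G z) < \<delta>}"
proof -
  have conn: "connected {z. \<bar>Im z\<bar> < h}"
  proof -
    have "{z. \<bar>Im z\<bar> < h} = {z. Im z < h} \<inter> {z. Im z > - h}" by auto
    then show ?thesis
      by (simp add: convex_Int convex_halfspace_Im_gt convex_halfspace_Im_lt convex_connected)
  qed
  have K: "compact (complex_of_real ` {0..1})" "complex_of_real ` {0..1} \<subseteq> {z. \<bar>Im z\<bar> < h}"
    using h by (auto intro!: compact_continuous_image continuous_intros)
  obtain r n C where rnC: "r > 0" "n > 0" "C > 0"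
    and cover: "\<And>e \<delta>. 0 < \<delta> \<Longrightarrow> \<delta> \<le> 1 \<Longrightarrow> diameter_cover n (C * \<delta> powr (1 / real n))
      {z \<in> (\<Union>x\<in>complex_of_real ` {0..1}. ball x r). cmod (e - G z) < \<delta>}"
    by (rule compact_sublevel_cover[OF holG strip_open conn G_nonconstant K]) (rule that; blast)
  show ?thesis
  proof (rule that)
    \<comment> \<open>Halving \<open>h\<close> keeps the closed strip inside the domain of
      \<open>G\<close>; the bound 1 later ensures that the threshold \<delta> is at most 1.\<close>
    show "0 < min r (min (h / 2) 1)" "min r (min (h / 2) 1) < h" "min r (min (h / 2) 1) \<le> 1" "n > 0" "C > 0"
      using rnC h by auto
    fix e :: complex and \<delta> :: real assume \<delta>: "0 < \<delta>" "\<delta> \<le> 1"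
    show "diameter_cover n (C * \<delta> powr (1 / real n))
      {z. Re z \<in> {0..1} \<and> \<bar>Im z\<bar> < min r (min (h / 2) 1) \<and> cmod (e - G z) < \<delta>}"
    proof (rule diameter_cover_mono[OF cover[OF \<delta>, of e] order_refl order_refl], rule subsetI)
      fix z assume z: "z \<in> {z. Re z \<in> {0..1} \<and> \<bar>Im z\<bar> < min r (min (h / 2) 1) \<and> cmod (e - G z) < \<delta>}"
      have "dist (complex_of_real (Re z)) z = \<bar>Im z\<bar>"
        by (simp add: dist_norm cmod_def)
      then show "z \<in> {z \<in> (\<Union>x\<in>complex_of_real ` {0..1}. ball x r). cmod (e - G z) < \<delta>}"
        using z by (auto intro!: bexI[of _ "Re z"])
    qed
  qed
qed

text \<open>One complex cover is projected in two ways. Its real parts bound the measure of the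
  sublevel sets of \<open>\<bar>e - f x\<bar>\<close>, hence a negative moment. Its imaginary parts
  bound the measure of the heights whose line meets the sublevel set of \<open>e - G\<close>, so
  these cannot fill an interval of length \<sigma>.\<close>

lemma uniform_regularity:
  obtains r n K c where "0 < r" "r < h" "r \<le> 1" "n > 0" "K \<ge> 0" "c > 0"
    "\<forall>e. powr_integrable (\<lambda>x. \<bar>e - f x\<bar>) (1 / (2 * real n)) K"
    "\<forall>e a \<sigma>. 0 < a \<and> 0 < \<sigma> \<and> a + \<sigma> < r \<longrightarrow>
      (\<exists>y\<in>{a..a + \<sigma>}. \<forall>x. (c * \<sigma>) ^ n \<le> cmod (e - G (Complex x y)))"
proof -
  obtain r n C where rnC: "0 < r" "r < h" "r \<le> 1" "n > 0" "C > 0"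
    and cover: "\<And>e \<delta>. 0 < \<delta> \<Longrightarrow> \<delta> \<le> 1 \<Longrightarrow> diameter_cover n (C * \<delta> powr (1 / real n))
      {z. Re z \<in> {0..1} \<and> \<bar>Im z\<bar> < r \<and> cmod (e - G z) < \<delta>}"
    by (rule sublevel_regularity) (rule that; blast)
  \<comment> \<open>Half the sublevel exponent 1/n, as the moment estimate requires.\<close>
  define p where "p = 1 / (2 * real n)"
  have p: "0 < p" "p \<le> 1" "2 * p = 1 / real n" using rnC by (auto simp: p_def field_simps)
  define B where "B = real n * (2 * C)"
  have "B > 0" using rnC by (simp add: B_def)
  define K where "K = 1 + B * 2 powr p / (1 - 2 powr - p)"
  have "2 powr - p < (2::real) powr 0" using p by (intro powr_less_mono) auto
  then have "K \<ge> 0" using \<open>B > 0\<close> unfolding K_def by (intro add_nonneg_nonneg divide_nonneg_nonneg) auto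
  \<comment> \<open>With \<delta> = (c \<sigma>)^n the bad heights have measure at most B c \<sigma>
    \<le> \<sigma>/2; the minimum with 1 keeps \<delta> \<le> 1.\<close>
  define c where "c = min 1 (1 / (2 * B))"
  have "c > 0" using \<open>B > 0\<close> by (simp add: c_def)
  show ?thesis
  proof (rule that[OF rnC(1-4) \<open>K \<ge> 0\<close> \<open>c > 0\<close>]; intro allI impI)
    fix e :: real
    have meas[measurable]: "(\<lambda>x. \<bar>e - f x\<bar>) \<in> borel_measurable borel"
      by (intro borel_measurable_continuous_onI continuous_intros f_continuous)
    have sublevel: "emeasure lborel {x \<in> {0..1}. \<bar>e - f x\<bar> < \<delta>} \<le> ennreal (B * \<delta> powr (2 * p))"
      if \<delta>: "0 < \<delta>" "\<delta> \<le> 1" for \<delta>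
    proof -
      have "diameter_cover n (C * \<delta> powr (1 / real n))
        (Re ` {z. Re z \<in> {0..1} \<and> \<bar>Im z\<bar> < r \<and> cmod (of_real e - G z) < \<delta>})"
        by (rule diameter_cover_image[OF cover[OF \<delta>]])
          (use abs_Re_le_cmod[of "_ - _"] in \<open>simp add: dist_norm\<close>)
      then obtain U where U: "U \<in> sets lborel"
        "Re ` {z. Re z \<in> {0..1} \<and> \<bar>Im z\<bar> < r \<and> cmod (of_real e - G z) < \<delta>} \<subseteq> U"
        "emeasure lborel U \<le> ennreal (real n * (2 * (C * \<delta> powr (1 / real n))))"
        by (rule diameter_cover_measure) (use rnC in simp)
      have "{x \<in> {0..1}. \<bar>e - f x\<bar> < \<delta>} \<subseteq> U"
      proof
        fix x assume x: "x \<in> {x \<in> {0..1}. \<bar>e - f x\<bar> < \<delta>}"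
        then have "cmod (of_real e - G (of_real x)) < \<delta>" by (simp add: G_real flip: of_real_diff)
        then have "Re (of_real x) \<in> U"
          using x rnC by (intro subsetD[OF U(2)] imageI) auto
        then show "x \<in> U" by simp
      qed
      then have "emeasure lborel {x \<in> {0..1}. \<bar>e - f x\<bar> < \<delta>} \<le> emeasure lborel U"
        by (rule emeasure_mono[OF _ U(1)])
      also note U(3)
      finally show ?thesis by (simp add: B_def p mult.assoc)
    qed
    show "powr_integrable (\<lambda>x. \<bar>e - f x\<bar>) (1 / (2 * real n)) K"
      unfolding p_def[symmetric]
    proof
      show "continuous_on UNIV (\<lambda>x. \<bar>e - f x\<bar>)" by (intro continuous_intros f_continuous)
      show "AE x in lborel. x \<in> {0..1} \<longrightarrow> \<bar>e - f x\<bar> \<noteq> 0"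
        by (rule AE_nonzero_of_sublevel[OF meas _ sublevel]) (use p(1) in auto)
      show "(\<integral>\<^sup>+x. ennreal (\<bar>e - f x\<bar> powr - p) * indicator {0..1} x \<partial>lborel) \<le> ennreal K"
        unfolding K_def
        by (rule nn_integral_powr_minus_le[OF meas _ _ _ sublevel]) (use p(1) \<open>B > 0\<close> in auto)
    qed (use p \<open>K \<ge> 0\<close> in auto)
  next
    fix e :: complex and a \<sigma> :: real
    assume a: "0 < a \<and> 0 < \<sigma> \<and> a + \<sigma> < r"
    define \<delta> where "\<delta> = (c * \<sigma>) ^ n"
    have "c * \<sigma> \<le> 1 * 1" using a rnC \<open>c > 0\<close> by (intro mult_mono) (auto simp: c_def)
    then have \<delta>: "0 < \<delta>" "\<delta> \<le> 1" using a \<open>c > 0\<close> by (auto simp: \<delta>_def power_le_one)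
    have root: "\<delta> powr (1 / real n) = c * \<sigma>"
    proof -
      have "\<delta> = (c * \<sigma>) powr real n" using a \<open>c > 0\<close> by (simp add: \<delta>_def powr_realpow)
      then show ?thesis using a \<open>c > 0\<close> rnC by (simp add: powr_powr)
    qed
    show "\<exists>y\<in>{a..a + \<sigma>}. \<forall>x. (c * \<sigma>) ^ n \<le> cmod (e - G (Complex x y))"
    proof (rule ccontr)
      assume neg: "\<not> ?thesis"
      have bad: "\<exists>x. cmod (e - G (Complex x y)) < \<delta>" if "y \<in> {a..a + \<sigma>}" for y
      proof (rule ccontr)
        assume "\<nexists>x. cmod (e - G (Complex x y)) < \<delta>"
        then have "\<forall>x. \<delta> \<le> cmod (e - G (Complex x y))" by (simp add: not_less)
        with that neg show False unfolding \<delta>_def by blast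
      qed
      have "diameter_cover n (C * \<delta> powr (1 / real n))
        (Im ` {z. Re z \<in> {0..1} \<and> \<bar>Im z\<bar> < r \<and> cmod (e - G z) < \<delta>})"
        by (rule diameter_cover_image[OF cover[OF \<delta>]])
          (use abs_Im_le_cmod[of "_ - _"] in \<open>simp add: dist_norm\<close>)
      then obtain U where U: "U \<in> sets lborel"
        "Im ` {z. Re z \<in> {0..1} \<and> \<bar>Im z\<bar> < r \<and> cmod (e - G z) < \<delta>} \<subseteq> U"
        "emeasure lborel U \<le> ennreal (real n * (2 * (C * \<delta> powr (1 / real n))))"
        by (rule diameter_cover_measure) (use rnC in simp)
      have "{a..a + \<sigma>} \<subseteq> U"
      proof
        fix y assume y: "y \<in> {a..a + \<sigma>}"
        then have "\<bar>y\<bar> < r" "\<bar>y\<bar> < h" using a rnC by auto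
        obtain x where "cmod (e - G (Complex x y)) < \<delta>" using bad[OF y] by blast
        then have "cmod (e - G (Complex (frac x) y)) < \<delta>" using G_frac[OF \<open>\<bar>y\<bar> < h\<close>, of x] by simp
        then have "Im (Complex (frac x) y) \<in> U"
          using \<open>\<bar>y\<bar> < r\<close> frac_lt_1[of x] by (intro subsetD[OF U(2)] imageI) (auto intro: less_imp_le)
        then show "y \<in> U" by simp
      qed
      then have "emeasure lborel {a..a + \<sigma>} \<le> emeasure lborel U" by (rule emeasure_mono[OF _ U(1)])
      also note U(3)
      finally have "ennreal \<sigma> \<le> ennreal (B * (c * \<sigma>))" using a by (simp add: root B_def mult.assoc)
      then have "\<sigma> \<le> B * (c * \<sigma>)" using a \<open>B > 0\<close> \<open>c > 0\<close> by (simp add: ennreal_le_iff)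
      also have "B * (c * \<sigma>) \<le> B * (1 / (2 * B) * \<sigma>)"
        using a \<open>B > 0\<close> by (intro mult_left_mono mult_right_mono) (auto simp: c_def)
      also have "\<dots> = \<sigma> / 2" using \<open>B > 0\<close> by simp
      finally show False using a by simp
    qed
  qed
qed

section \<open>Comparison of log means on and off the real line\<close>

text \<open>The derivative of \<open>G\<close> is bounded on a compact rectangle over one period,
  and periodicity carries the estimate to all \<open>x\<close>.\<close>

lemma vertical_lipschitz:
  assumes "0 < r" "r < h"
  obtains M where "M \<ge> 1" "\<And>x y. \<bar>y\<bar> \<le> r \<Longrightarrow> cmod (G (Complex x y) - of_real (f x)) \<le> M * \<bar>y\<bar>"
proof -
  define Q where "Q = cbox (Complex 0 (- r)) (Complex 1 r)"
  have Q: "z \<in> Q \<longleftrightarrow> Re z \<in> {0..1} \<and> \<bar>Im z\<bar> \<le> r" for z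
    by (auto simp: Q_def in_cbox_complex_iff abs_le_iff)
  have sub: "Q \<subseteq> {z. \<bar>Im z\<bar> < h}" using Q assms by auto
  have "continuous_on Q (deriv G)"
    using holomorphic_on_imp_continuous_on[OF holomorphic_deriv[OF holG strip_open]] sub
    by (rule continuous_on_subset)
  then have "bounded (deriv G ` Q)"
    unfolding Q_def by (intro compact_imp_bounded compact_continuous_image compact_cbox)
  then obtain M where M: "\<And>z. z \<in> Q \<Longrightarrow> cmod (deriv G z) \<le> M"
    unfolding bounded_iff by auto
  show ?thesis
  proof (rule that)
    show "max M 1 \<ge> 1" by simp
    fix x y :: real assume y: "\<bar>y\<bar> \<le> r"
    have "cmod (G (Complex (frac x) y) - G (Complex (frac x) 0)) \<le> max M 1 * cmod (Complex (frac x) y - Complex (frac x) 0)"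
    proof (rule field_differentiable_bound[of Q G "deriv G"])
      show "convex Q" unfolding Q_def by (rule convex_box)
      show "(G has_field_derivative deriv G z) (at z within Q)" if "z \<in> Q" for z
        by (rule has_field_derivative_at_within[OF holomorphic_derivI[OF holG strip_open subsetD[OF sub that]]])
      show "cmod (deriv G z) \<le> max M 1" if "z \<in> Q" for z using M[OF that] by simp
      show "Complex (frac x) y \<in> Q" "Complex (frac x) 0 \<in> Q"
        using y assms frac_lt_1[of x] unfolding Q by (auto intro: less_imp_le)
    qed
    moreover have "cmod (Complex (frac x) y - Complex (frac x) 0) = \<bar>y\<bar>" by (simp add: cmod_def)
    ultimately show "cmod (G (Complex x y) - of_real (f x)) \<le> max M 1 * \<bar>y\<bar>"
      using G_frac[of y x] G_frac[of 0 x] y assms h by (simp add: G_Complex_0)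
  qed
qed

lemma G_line_continuous: "\<bar>y\<bar> < h \<Longrightarrow> continuous_on UNIV (\<lambda>x. G (Complex x y))"
  by (rule continuous_on_horizontal_line[OF holG])

lemma set_integrable_ln_line:
  assumes "\<bar>y\<bar> < h" "\<delta> > 0" "\<And>x. \<delta> \<le> cmod (e - G (Complex x y))"
  shows "set_integrable lborel {0..1} (\<lambda>x. ln (cmod (e - G (Complex x y))))"
proof (intro set_integrable_unit_interval continuous_on_ln continuous_intros G_line_continuous assms(1) ballI)
  fix x show "cmod (e - G (Complex x y)) \<noteq> 0" using assms(2) assms(3)[of x] by linarith
qed

text \<open>The log mean is convex in the height of the line, and even because \<open>G\<close> commutes with conjugation.\<close>

lemma line_log_mean_ge:
  assumes y: "\<bar>y\<bar> < h" and \<delta>: "\<delta> > 0" "\<And>x. \<delta> \<le> cmod (of_real e - G (Complex x y))"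
    and "powr_integrable (\<lambda>x. \<bar>e - f x\<bar>) p K"
  shows "(LINT x:{0..1}|lborel. ln \<bar>e - f x\<bar>) \<le> (LINT x:{0..1}|lborel. ln (cmod (of_real e - G (Complex x y))))"
proof (rule field_le_epsilon)
  interpret powr_integrable "\<lambda>x. \<bar>e - f x\<bar>" p K by fact
  fix \<eta> :: real assume "\<eta> > 0"
  \<comment> \<open>On the line the modulus is at least \<delta>, so regularizing there costs at
    most \<epsilon> / (2 \<delta>^2) = \<eta>.\<close>
  define \<epsilon> where "\<epsilon> = 2 * \<delta>\<^sup>2 * \<eta>"
  have "\<epsilon> > 0" using \<open>\<eta> > 0\<close> \<delta> by (simp add: \<epsilon>_def)
  define P where "P = (\<lambda>z. of_real e - G z)"
  have holP: "P holomorphic_on {z. \<bar>Im z\<bar> < h}" unfolding P_def by (intro holomorphic_intros holG)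
  define \<phi> where "\<phi> = (\<lambda>t x. ln ((cmod (P (Complex x t)))\<^sup>2 + \<epsilon>) / 2)"
  have conv: "convex_on {-h<..<h} (\<lambda>t. integral {0..1} (\<phi> t))"
    unfolding \<phi>_def by (rule convex_on_log_mean[OF holP]) (auto simp: P_def G_periodic \<open>\<epsilon> > 0\<close>)
  have int\<phi>: "set_integrable lborel {0..1} (\<phi> t)" if "\<bar>t\<bar> < h" for t
  proof -
    have "s\<^sup>2 + \<epsilon> \<noteq> 0" for s :: real using zero_le_power2[of s] \<open>\<epsilon> > 0\<close> by linarith
    then show ?thesis unfolding \<phi>_def
      by (intro set_integrable_unit_interval continuous_intros continuous_on_horizontal_line[OF holP that]) auto
  qed
  have HK: "integral {0..1} (\<phi> t) = (LINT x:{0..1}|lborel. \<phi> t x)" if "\<bar>t\<bar> < h" for t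
    using set_borel_integral_eq_integral(2)[OF int\<phi>[OF that]] by simp
  have even: "\<phi> (- y) = \<phi> y"
  proof
    fix x
    have "Complex x (- y) = cnj (Complex x y)" by (simp add: complex_eq_iff)
    then have "P (Complex x (- y)) = cnj (P (Complex x y))" by (simp only: P_def G_cnj complex_cnj_diff complex_cnj_complex_of_real)
    then show "\<phi> (- y) x = \<phi> y x" by (simp add: \<phi>_def)
  qed
  have "(LINT x:{0..1}|lborel. ln \<bar>e - f x\<bar>) \<le> (LINT x:{0..1}|lborel. \<phi> 0 x)"
  proof (rule set_integral_mono_AE[OF set_integrable_ln int\<phi>])
    show "\<bar>0\<bar> < h" using h by simp
    show "AE x\<in>{0..1} in lborel. ln \<bar>e - f x\<bar> \<le> \<phi> 0 x"
      using AE_nonzero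
    proof eventually_elim
      case (elim x)
      show ?case
      proof
        assume "x \<in> {0..1}"
        then have pos: "\<bar>e - f x\<bar> > 0" using elim by simp
        have "ln \<bar>e - f x\<bar> = ln (\<bar>e - f x\<bar>\<^sup>2) / 2" using pos by (subst ln_realpow) auto
        also have "\<dots> \<le> ln (\<bar>e - f x\<bar>\<^sup>2 + \<epsilon>) / 2" using pos \<open>\<epsilon> > 0\<close> by (intro divide_right_mono ln_mono) auto
        also have "\<bar>e - f x\<bar> = cmod (P (Complex x 0))" by (simp add: P_def G_Complex_0 flip: of_real_diff)
        finally show "ln \<bar>e - f x\<bar> \<le> \<phi> 0 x" by (simp add: \<phi>_def P_def G_Complex_0 flip: of_real_diff)
      qed
    qed
  qed
  also have "\<dots> = integral {0..1} (\<phi> 0)" using HK[of 0] h by simp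
  also have "\<dots> \<le> (1 - 1/2) * integral {0..1} (\<phi> (- y)) + 1/2 * integral {0..1} (\<phi> y)"
    using convex_onD[OF conv, of "1/2" "- y" y] y by (simp add: abs_less_iff)
  also have "\<dots> = (LINT x:{0..1}|lborel. \<phi> y x)" using HK[OF y] by (simp add: even)
  also have "\<dots> \<le> (LINT x:{0..1}|lborel. ln (cmod (of_real e - G (Complex x y))) + \<eta>)"
  proof (rule set_integral_mono[OF int\<phi>[OF y]])
    show "set_integrable lborel {0..1} (\<lambda>x. ln (cmod (of_real e - G (Complex x y))) + \<eta>)"
      by (intro set_integral_add set_integrable_ln_line[OF y \<delta>] set_integrable_unit_interval continuous_on_const)
    fix x
    define b where "b = cmod (of_real e - G (Complex x y))"
    have b: "\<delta> \<le> b" "b > 0" using \<delta>(2)[of x] \<delta>(1) by (auto simp: b_def)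
    have "ln (b\<^sup>2 + \<epsilon>) = ln (b\<^sup>2 * (1 + \<epsilon> / b\<^sup>2))" using b by (simp add: distrib_left)
    also have "\<dots> = ln (b\<^sup>2) + ln (1 + \<epsilon> / b\<^sup>2)" using b \<open>\<epsilon> > 0\<close> by (intro ln_mult_pos) (auto intro: add_pos_pos)
    also have "ln (b\<^sup>2) = 2 * ln b" using b by (simp add: ln_realpow)
    also have "ln (1 + \<epsilon> / b\<^sup>2) \<le> \<epsilon> / b\<^sup>2" using \<open>\<epsilon> > 0\<close> by (intro ln_add_one_self_le_self) simp
    also have "\<epsilon> / b\<^sup>2 \<le> \<epsilon> / \<delta>\<^sup>2" using b \<delta> \<open>\<epsilon> > 0\<close> by (intro divide_left_mono power_mono) auto
    also have "\<epsilon> / \<delta>\<^sup>2 = 2 * \<eta>" using \<delta> by (simp add: \<epsilon>_def)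
    finally show "\<phi> y x \<le> ln (cmod (of_real e - G (Complex x y))) + \<eta>" by (simp add: \<phi>_def P_def b_def)
  qed
  also have "\<dots> = (LINT x:{0..1}|lborel. ln (cmod (of_real e - G (Complex x y)))) + \<eta>"
    by (subst set_integral_add(2)[OF set_integrable_ln_line[OF y \<delta>]])
      (auto intro!: set_integrable_unit_interval simp: set_lebesgue_integral_def)
  finally show "(LINT x:{0..1}|lborel. ln \<bar>e - f x\<bar>)
    \<le> (LINT x:{0..1}|lborel. ln (cmod (of_real e - G (Complex x y)))) + \<eta>" .
qed

text \<open>The modulus on the line exceeds \<open>\<bar>e - f x\<bar>\<close> by at most \<kappa>,
  and the negative moment controls the effect of adding \<kappa> under the logarithm.\<close>

lemma line_log_mean_le:
  assumes y: "\<bar>y\<bar> < h" and \<delta>: "\<delta> > 0" "\<And>x. \<delta> \<le> cmod (of_real e - G (Complex x y))"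
    and "powr_integrable (\<lambda>x. \<bar>e - f x\<bar>) p K" and \<kappa>: "0 < \<kappa>" "\<kappa> \<le> 1"
    and close: "\<And>x. cmod (G (Complex x y) - of_real (f x)) \<le> \<kappa>"
  shows "(LINT x:{0..1}|lborel. ln (cmod (of_real e - G (Complex x y))))
    \<le> (LINT x:{0..1}|lborel. ln \<bar>e - f x\<bar>) + (1 + 1 / p) * K * \<kappa> powr p"
proof -
  interpret powr_integrable "\<lambda>x. \<bar>e - f x\<bar>" p K by fact
  have "(LINT x:{0..1}|lborel. ln (cmod (of_real e - G (Complex x y))))
    \<le> (LINT x:{0..1}|lborel. ln (\<bar>e - f x\<bar> + \<kappa>))"
  proof (rule set_integral_mono[OF set_integrable_ln_line[OF y \<delta>]])
    show "set_integrable lborel {0..1} (\<lambda>x. ln (\<bar>e - f x\<bar> + \<kappa>))"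
    proof (intro set_integrable_unit_interval continuous_on_ln continuous_intros f_continuous ballI)
      fix x show "\<bar>e - f x\<bar> + \<kappa> \<noteq> 0" using \<kappa> by linarith
    qed
    fix x
    have "of_real e - G (Complex x y) = of_real (e - f x) - (G (Complex x y) - of_real (f x))" by simp
    then have "cmod (of_real e - G (Complex x y))
        \<le> cmod (of_real (e - f x)) + cmod (G (Complex x y) - of_real (f x))"
      by (simp only: norm_triangle_ineq4)
    then have "cmod (of_real e - G (Complex x y)) \<le> \<bar>e - f x\<bar> + \<kappa>"
      using close[of x] unfolding norm_of_real by linarith
    then show "ln (cmod (of_real e - G (Complex x y))) \<le> ln (\<bar>e - f x\<bar> + \<kappa>)"
      using \<delta>(1) \<delta>(2)[of x] by (intro ln_mono) linarith+
  qed
  also note set_lebesgue_integral_ln_add_le[OF \<kappa>]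
  finally show ?thesis .
qed

end

section \<open>Asymptotics for large coupling\<close>

context circle_extension
begin

lemma schroedinger_cocycle: "schroedinger_cocycle f"
  by unfold_locales (rule f_continuous, rule f_periodic)

lemma abs_potential:
  assumes "lam \<noteq> 0"
  shows "\<bar>E - lam * f x\<bar> = \<bar>lam\<bar> * \<bar>E / lam - f x\<bar>"
  using assms by (simp add: right_diff_distrib flip: abs_mult)

text \<open>After extracting \<open>\<bar>lam\<bar>\<close>, the summand 1 in the one-step norm
  bound becomes a shift by \<open>1 / \<bar>lam\<bar>\<close> under the logarithm.\<close>

lemma lyapunov_exponent_upper_bound:
  assumes "\<bar>lam\<bar> \<ge> 1" and reg: "powr_integrable (\<lambda>x. \<bar>E / lam - f x\<bar>) p K"
  shows "lyapunov_exponent \<alpha> (schroedinger_matrix f lam E)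
    \<le> ln \<bar>lam\<bar> + (LINT x:{0..1}|lborel. ln \<bar>E / lam - f x\<bar>) + (1 + 1 / p) * K * \<bar>lam\<bar> powr - p"
proof -
  interpret powr_integrable "\<lambda>x. \<bar>E / lam - f x\<bar>" p K by fact
  interpret schroedinger_cocycle f \<alpha> lam E by (rule schroedinger_cocycle)
  have "lam \<noteq> 0" using assms by auto
  have pos: "\<bar>E / lam - f x\<bar> + 1 / \<bar>lam\<bar> > 0" for x using \<open>lam \<noteq> 0\<close> by (simp add: add_nonneg_pos)
  have "lyapunov_exponent \<alpha> (schroedinger_matrix f lam E) \<le> (LINT x:{0..1}|lborel. ln (\<bar>E - lam * f x\<bar> + 1))"
    by (rule lyapunov_exponent_le)
  also have "(\<lambda>x. ln (\<bar>E - lam * f x\<bar> + 1)) = (\<lambda>x. ln \<bar>lam\<bar> + ln (\<bar>E / lam - f x\<bar> + 1 / \<bar>lam\<bar>))"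
  proof
    fix x
    have "\<bar>E - lam * f x\<bar> + 1 = \<bar>lam\<bar> * (\<bar>E / lam - f x\<bar> + 1 / \<bar>lam\<bar>)"
      using \<open>lam \<noteq> 0\<close> by (simp add: abs_potential distrib_left)
    moreover have "0 < \<bar>lam\<bar>" using \<open>lam \<noteq> 0\<close> by simp
    ultimately show "ln (\<bar>E - lam * f x\<bar> + 1) = ln \<bar>lam\<bar> + ln (\<bar>E / lam - f x\<bar> + 1 / \<bar>lam\<bar>)"
      by (simp only: ln_mult_pos[OF _ pos])
  qed
  also have "(LINT x:{0..1}|lborel. ln \<bar>lam\<bar> + ln (\<bar>E / lam - f x\<bar> + 1 / \<bar>lam\<bar>))
    = ln \<bar>lam\<bar> + (LINT x:{0..1}|lborel. ln (\<bar>E / lam - f x\<bar> + 1 / \<bar>lam\<bar>))"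
  proof (subst set_integral_add(2))
    have "\<bar>E / lam - f x\<bar> + 1 / \<bar>lam\<bar> \<noteq> 0" for x using pos[of x] by linarith
    then show "set_integrable lborel {0..1} (\<lambda>x. ln (\<bar>E / lam - f x\<bar> + 1 / \<bar>lam\<bar>))"
      by (intro set_integrable_unit_interval continuous_on_ln continuous_on_add
          powr_integrable.cont[OF reg] continuous_on_const ballI)
  qed (auto intro!: set_integrable_unit_interval simp: set_lebesgue_integral_def)
  also have "(LINT x:{0..1}|lborel. ln (\<bar>E / lam - f x\<bar> + 1 / \<bar>lam\<bar>))
    \<le> (LINT x:{0..1}|lborel. ln \<bar>E / lam - f x\<bar>) + (1 + 1 / p) * K * (1 / \<bar>lam\<bar>) powr p"
    using assms by (intro set_lebesgue_integral_ln_add_le) (auto simp: \<open>lam \<noteq> 0\<close>)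
  also have "(1 / \<bar>lam\<bar>) powr p = \<bar>lam\<bar> powr - p" using \<open>lam \<noteq> 0\<close> by (simp add: powr_divide powr_minus_divide)
  finally show ?thesis by simp
qed

text \<open>Applies the two-line estimate with D = |lam| \<delta>. The mean at \<open>y1\<close> is
  at least the real one by convexity and evenness; only the upper estimate at \<open>y2\<close>
  needs the line to be close to the real axis.\<close>

lemma lyapunov_exponent_lower_bound:
  assumes "lam \<noteq> 0" and reg: "powr_integrable (\<lambda>x. \<bar>E / lam - f x\<bar>) p K"
    and y: "0 < y1" "2 * y1 \<le> y2" "y2 < h" and "\<delta> > 0" "\<bar>lam\<bar> * \<delta> \<ge> 2"
    and line1: "\<And>x. \<delta> \<le> cmod (of_real (E / lam) - G (Complex x y1))"
    and line2: "\<And>x. \<delta> \<le> cmod (of_real (E / lam) - G (Complex x y2))"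
    and \<kappa>: "0 < \<kappa>" "\<kappa> \<le> 1" "\<And>x. cmod (G (Complex x y2) - of_real (f x)) \<le> \<kappa>"
  shows "ln \<bar>lam\<bar> + (LINT x:{0..1}|lborel. ln \<bar>E / lam - f x\<bar>) - 6 / (\<bar>lam\<bar> * \<delta>) - (1 + 1 / p) * K * \<kappa> powr p
    \<le> lyapunov_exponent \<alpha> (schroedinger_matrix f lam E)"
proof -
  interpret powr_integrable "\<lambda>x. \<bar>E / lam - f x\<bar>" p K by fact
  interpret schroedinger_cocycle f \<alpha> lam E by (rule schroedinger_cocycle)
  define v where "v = (\<lambda>z. of_real E - of_real lam * G z)"
  interpret analytic_schroedinger_cocycle f \<alpha> lam E v h
  proof
    show "v holomorphic_on {z. \<bar>Im z\<bar> < h}" unfolding v_def by (intro holomorphic_intros holG)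
  qed (simp_all add: v_def G_periodic G_real)
  have v: "cmod (v z) = \<bar>lam\<bar> * cmod (of_real (E / lam) - G z)" for z
  proof -
    have "v z = of_real lam * (of_real (E / lam) - G z)"
      using \<open>lam \<noteq> 0\<close> by (simp add: v_def algebra_simps)
    then show ?thesis by (simp only: norm_mult norm_of_real)
  qed
  have mean: "line_mean y = ln \<bar>lam\<bar> + (LINT x:{0..1}|lborel. ln (cmod (of_real (E / lam) - G (Complex x y))))"
    if "\<bar>y\<bar> < h" and "\<And>x. \<delta> \<le> cmod (of_real (E / lam) - G (Complex x y))" for y
  proof -
    have "ln (cmod (v (Complex x y))) = ln \<bar>lam\<bar> + ln (cmod (of_real (E / lam) - G (Complex x y)))" for x
      unfolding v using \<open>lam \<noteq> 0\<close> that(2)[of x] \<open>\<delta> > 0\<close> by (intro ln_mult_pos) linarith+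
    then have "line_mean y = (LINT x:{0..1}|lborel. ln \<bar>lam\<bar> + ln (cmod (of_real (E / lam) - G (Complex x y))))"
      unfolding line_mean_def by simp
    also have "\<dots> = ln \<bar>lam\<bar> + (LINT x:{0..1}|lborel. ln (cmod (of_real (E / lam) - G (Complex x y))))"
      by (subst set_integral_add(2)[OF _ set_integrable_ln_line[OF that(1) \<open>\<delta> > 0\<close> that(2)]])
        (auto intro!: set_integrable_unit_interval simp: set_lebesgue_integral_def)
    finally show ?thesis .
  qed
  have "\<bar>y1\<bar> < h" "\<bar>y2\<bar> < h" using y by auto
  let ?J = "ln \<bar>lam\<bar> + (LINT x:{0..1}|lborel. ln \<bar>E / lam - f x\<bar>)"
  have "?J - 6 / (\<bar>lam\<bar> * \<delta>) - (1 + 1 / p) * K * \<kappa> powr p \<le> lyapunov_exponent \<alpha> A"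
  proof (rule lyapunov_exponent_ge_line_means[OF y])
    show "\<bar>lam\<bar> * \<delta> \<le> cmod (v (Complex x y1))" "\<bar>lam\<bar> * \<delta> \<le> cmod (v (Complex x y2))" for x
      unfolding v using line1 line2 by (auto intro: mult_left_mono)
    show "0 \<le> (1 + 1 / p) * K * \<kappa> powr p" using p K by simp
    show "?J \<le> line_mean y1"
      using line_log_mean_ge[OF \<open>\<bar>y1\<bar> < h\<close> \<open>\<delta> > 0\<close> line1 reg] mean[OF \<open>\<bar>y1\<bar> < h\<close> line1] by simp
    show "line_mean y2 \<le> ?J + (1 + 1 / p) * K * \<kappa> powr p"
      using line_log_mean_le[OF \<open>\<bar>y2\<bar> < h\<close> \<open>\<delta> > 0\<close> line2 reg \<kappa>] mean[OF \<open>\<bar>y2\<bar> < h\<close> line2] by simp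
  qed fact
  then show ?thesis .
qed

lemma lyapunov_exponent_asymptotics:
  obtains lam0 C :: real and n :: nat where "lam0 \<ge> 1" "C > 0" "n > 0"
    "\<forall>\<alpha> lam E. \<bar>lam\<bar> > lam0 \<longrightarrow>
      \<bar>lyapunov_exponent \<alpha> (schroedinger_matrix f lam E)
        - (ln \<bar>lam\<bar> + (LINT x:{0..1}|lborel. ln \<bar>E / lam - f x\<bar>))\<bar>
      \<le> C * \<bar>lam\<bar> powr (- (1 / (4 * (real n)\<^sup>2)))"
proof -
  obtain r n K c where rn: "0 < r" "r < h" "r \<le> 1" "n > 0" and K: "K \<ge> 0" and c: "c > 0"
    and reg: "\<forall>e. powr_integrable (\<lambda>x. \<bar>e - f x\<bar>) (1 / (2 * real n)) K"
    and lines: "\<forall>e a \<sigma>. 0 < a \<and> 0 < \<sigma> \<and> a + \<sigma> < r \<longrightarrow>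
      (\<exists>y\<in>{a..a + \<sigma>}. \<forall>x. (c * \<sigma>) ^ n \<le> cmod (e - G (Complex x y)))"
    by (rule uniform_regularity)
  obtain M where M: "M \<ge> 1" "\<And>x y. \<bar>y\<bar> \<le> r \<Longrightarrow> cmod (G (Complex x y) - of_real (f x)) \<le> M * \<bar>y\<bar>"
    using vertical_lipschitz[OF rn(1,2)] by blast
  define p where "p = 1 / (2 * real n)"
  have p: "0 < p" "p \<le> 1 / 2" "p * real n = 1 / 2" using rn by (auto simp: p_def field_simps)
  define q where "q = 1 / (4 * (real n)\<^sup>2)"
  have q: "q = p * p" by (simp add: q_def p_def power2_eq_square)
  have "q \<le> p" using p mult_left_mono[of p 1 p] by (simp add: q)
  \<comment> \<open>A ceiling for \<sigma>: the first bound keeps heights up to 5 \<sigma> below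
    \<open>r\<close>, the second makes \<kappa> = 5 M \<sigma> at most 1.\<close>
  define s where "s = min (r / 6) (1 / (5 * M))"
  have s: "0 < s" "s \<le> r / 6" "s \<le> 1 / (5 * M)" using rn M by (auto simp: s_def)
  \<comment> \<open>The second entry forces \<sigma> \<le> s; the third forces |lam| \<delta> = c^n
    |lam|^(1/2) to be at least 2.\<close>
  define lam0 where "lam0 = max 1 (max (s powr (- 1 / p)) (4 / (c ^ n)\<^sup>2))"
  define B where "B = (1 + 1 / p) * K"
  have "B \<ge> 0" using p K by (simp add: B_def)
  \<comment> \<open>One summand for each loss: the recursion on the lines, the passage from the real
    line to \<open>y2\<close>, and the one-step upper bound.\<close>
  define C where "C = 6 / c ^ n + B * (5 * M) powr p + B"
  show ?thesis
  proof (rule that; (intro allI impI)?)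
    show "lam0 \<ge> 1" by (simp add: lam0_def)
    show "C > 0" unfolding C_def using c \<open>B \<ge> 0\<close> by (intro add_pos_nonneg) auto
    show "n > 0" by (rule rn)
    fix \<alpha> lam E :: real assume "\<bar>lam\<bar> > lam0"
    then have lam: "\<bar>lam\<bar> > 1" "s powr (- 1 / p) < \<bar>lam\<bar>" "4 / (c ^ n)\<^sup>2 < \<bar>lam\<bar>" by (auto simp: lam0_def)
    have "lam \<noteq> 0" using lam by auto
    define \<sigma> where "\<sigma> = \<bar>lam\<bar> powr - p"
    have "\<sigma> > 0" using lam by (simp add: \<sigma>_def)
    have "\<sigma> \<le> (s powr (- 1 / p)) powr - p"
      unfolding \<sigma>_def using lam s p by (intro powr_mono2') auto
    also have "\<dots> = s" using s p by (simp add: powr_powr)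
    finally have "\<sigma> \<le> s" .
    define \<delta> where "\<delta> = (c * \<sigma>) ^ n"
    have "\<delta> > 0" using c \<open>\<sigma> > 0\<close> by (simp add: \<delta>_def)
    have "\<sigma> ^ n = \<bar>lam\<bar> powr - (p * real n)"
      using \<open>lam \<noteq> 0\<close> by (simp add: \<sigma>_def powr_powr flip: powr_realpow)
    then have "\<sigma> ^ n = \<bar>lam\<bar> powr (- (1 / 2))" by (simp only: p(3))
    then have \<delta>_eq: "\<bar>lam\<bar> * \<delta> = c ^ n * \<bar>lam\<bar> powr (1 / 2)"
      using lam powr_add[of "\<bar>lam\<bar>" 1 "- (1/2)"] by (simp add: \<delta>_def power_mult_distrib)
    have "\<bar>lam\<bar> * \<delta> \<ge> 2"
    proof -
      have "(2 / c ^ n)\<^sup>2 \<le> \<bar>lam\<bar>" using lam(3) by (simp add: power_divide)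
      then have "2 / c ^ n \<le> sqrt \<bar>lam\<bar>" by (rule real_le_rsqrt)
      then show ?thesis using c unfolding \<delta>_eq by (simp add: powr_half_sqrt field_simps)
    qed
    have "2 * \<sigma> < r" "5 * \<sigma> < r" using \<open>\<sigma> \<le> s\<close> s rn by linarith+
    \<comment> \<open>Good heights are sought in [\<sigma>, 2 \<sigma>] and
      [4 \<sigma>, 5 \<sigma>]; this separation guarantees \<open>2 * y1 \<le> y2\<close> wherever
      they fall.\<close>
    obtain y1 where y1: "\<sigma> \<le> y1" "y1 \<le> 2 * \<sigma>" "\<And>x. \<delta> \<le> cmod (of_real (E / lam) - G (Complex x y1))"
      using lines[rule_format, of \<sigma> \<sigma> "of_real (E / lam)"] \<open>\<sigma> > 0\<close> \<open>2 * \<sigma> < r\<close> by (auto simp: \<delta>_def)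
    obtain y2 where y2: "4 * \<sigma> \<le> y2" "y2 \<le> 5 * \<sigma>" "\<And>x. \<delta> \<le> cmod (of_real (E / lam) - G (Complex x y2))"
      using lines[rule_format, of "4 * \<sigma>" \<sigma> "of_real (E / lam)"] \<open>\<sigma> > 0\<close> \<open>5 * \<sigma> < r\<close> by (auto simp: \<delta>_def)
    \<comment> \<open>The error \<open>\<kappa> powr p\<close> is a multiple of |lam|^(-p^2), the
      slowest of the three decay rates and hence the source of the exponent
      \<open>q\<close>.\<close>
    define \<kappa> where "\<kappa> = 5 * M * \<sigma>"
    have "5 * M * \<sigma> \<le> 5 * M * (1 / (5 * M))"
      using M(1) s \<open>\<sigma> \<le> s\<close> by (intro mult_left_mono) linarith+
    then have \<kappa>: "0 < \<kappa>" "\<kappa> \<le> 1" using M(1) \<open>\<sigma> > 0\<close> by (auto simp: \<kappa>_def)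
    have close: "cmod (G (Complex x y2) - of_real (f x)) \<le> \<kappa>" for x
    proof -
      have "cmod (G (Complex x y2) - of_real (f x)) \<le> M * \<bar>y2\<bar>"
        using y2 \<open>\<sigma> > 0\<close> \<open>5 * \<sigma> < r\<close> by (intro M(2)) linarith
      also have "\<dots> \<le> M * (5 * \<sigma>)" using y2 \<open>\<sigma> > 0\<close> M(1) by (intro mult_left_mono) linarith+
      finally show ?thesis by (simp add: \<kappa>_def)
    qed
    let ?L = "lyapunov_exponent \<alpha> (schroedinger_matrix f lam E)"
    let ?J = "ln \<bar>lam\<bar> + (LINT x:{0..1}|lborel. ln \<bar>E / lam - f x\<bar>)"
    have reg': "powr_integrable (\<lambda>x. \<bar>E / lam - f x\<bar>) p K" unfolding p_def using reg by blast
    have "?L \<le> ?J + B * \<bar>lam\<bar> powr - p"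
      unfolding B_def using lam by (intro lyapunov_exponent_upper_bound reg') auto
    moreover have "?J - 6 / (\<bar>lam\<bar> * \<delta>) - B * \<kappa> powr p \<le> ?L"
      unfolding B_def
    proof (rule lyapunov_exponent_lower_bound[OF \<open>lam \<noteq> 0\<close> reg' _ _ _ \<open>\<delta> > 0\<close> \<open>\<bar>lam\<bar> * \<delta> \<ge> 2\<close> y1(3) y2(3) \<kappa> close])
      show "0 < y1" "2 * y1 \<le> y2" "y2 < h" using y1 y2 \<open>\<sigma> > 0\<close> \<open>5 * \<sigma> < r\<close> rn by linarith+
    qed
    moreover have "\<bar>lam\<bar> powr - p \<le> \<bar>lam\<bar> powr - q"
      using lam \<open>q \<le> p\<close> by (intro powr_mono) auto
    then have "B * \<bar>lam\<bar> powr - p \<le> B * \<bar>lam\<bar> powr - q" using \<open>B \<ge> 0\<close> by (rule mult_left_mono)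
    moreover have "6 / (\<bar>lam\<bar> * \<delta>) \<le> 6 / c ^ n * \<bar>lam\<bar> powr - q"
    proof -
      have "6 / (\<bar>lam\<bar> * \<delta>) = 6 / c ^ n * \<bar>lam\<bar> powr (- (1 / 2))"
        unfolding \<delta>_eq by (simp add: powr_minus_divide)
      also have "\<dots> \<le> 6 / c ^ n * \<bar>lam\<bar> powr - q"
        using lam c p \<open>q \<le> p\<close> by (intro mult_left_mono powr_mono) auto
      finally show ?thesis .
    qed
    moreover have "\<kappa> powr p = (5 * M) powr p * \<bar>lam\<bar> powr - q"
      using M(1) \<open>\<sigma> > 0\<close> by (simp add: \<kappa>_def \<sigma>_def powr_mult powr_powr q)
    then have "B * \<kappa> powr p = B * (5 * M) powr p * \<bar>lam\<bar> powr - q" by simp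
    moreover have "C * \<bar>lam\<bar> powr - q
      = 6 / c ^ n * \<bar>lam\<bar> powr - q + B * (5 * M) powr p * \<bar>lam\<bar> powr - q + B * \<bar>lam\<bar> powr - q"
      by (simp add: C_def algebra_simps)
    moreover have "0 \<le> 6 / c ^ n * \<bar>lam\<bar> powr - q" "0 \<le> B * (5 * M) powr p * \<bar>lam\<bar> powr - q"
        "0 \<le> B * \<bar>lam\<bar> powr - q"
      using c \<open>B \<ge> 0\<close> by simp_all
    ultimately show "\<bar>?L - ?J\<bar> \<le> C * \<bar>lam\<bar> powr - (1 / (4 * (real n)\<^sup>2))"
      unfolding q_def[symmetric] abs_le_iff by linarith
  qed
qed

end

theorem theorem1p1:
  fixes h \<rho> :: real and f :: "real \<Rightarrow> real"
  assumes "h > 0"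
    and "f \<in> analytic_circle_functions h"
    and "\<exists>x. f x \<noteq> 0"
    and "\<not> f constant_on UNIV"
    and "0 < \<rho>" and "\<rho> < 1 / 2 * min h 1"
  shows "\<exists>(lam0::real) (N::nat) (C::real). lam0 > 0 \<and> C > 0 \<and>
    (\<forall>\<alpha> lam E::real. \<alpha> \<notin> \<rat> \<longrightarrow> \<bar>lam\<bar> > lam0 \<longrightarrow>
      \<bar>lyapunov_exponent \<alpha> (schroedinger_matrix f lam E)
        - (ln \<bar>lam\<bar> + (LINT x:{0..1}|lborel. ln \<bar>E / lam - f x\<bar>))\<bar>
      \<le> C * \<bar>lam\<bar> powr (- (2 / (2 * real N + 1))))"
proof -
  obtain G where "circle_extension f G h"
    by (rule ex_circle_extension[OF assms(2,1,4)])
  then interpret circle_extension f G h .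
  obtain lam0 C :: real and n :: nat where bounds: "lam0 \<ge> 1" "C > 0" "n > 0"
    and asymp: "\<forall>\<alpha> lam E. \<bar>lam\<bar> > lam0 \<longrightarrow>
      \<bar>lyapunov_exponent \<alpha> (schroedinger_matrix f lam E)
        - (ln \<bar>lam\<bar> + (LINT x:{0..1}|lborel. ln \<bar>E / lam - f x\<bar>))\<bar>
      \<le> C * \<bar>lam\<bar> powr (- (1 / (4 * (real n)\<^sup>2)))"
    by (rule lyapunov_exponent_asymptotics)
  \<comment> \<open>With N = 4 n^2 this is 2 / (2N + 1) \<le> 1 / N; as |lam| > 1, the smaller
    exponent gives the weaker bound.\<close>
  have exponent: "2 / (2 * real (4 * n\<^sup>2) + 1) \<le> 1 / (4 * (real n)\<^sup>2)"
    using bounds(3) by (simp add: divide_simps add_pos_nonneg)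
  show ?thesis
  proof (rule exI[of _ lam0], rule exI[of _ "4 * n\<^sup>2"], rule exI[of _ C], intro conjI allI impI)
    show "lam0 > 0" "C > 0" using bounds by auto
    fix \<alpha> lam E :: real assume "\<alpha> \<notin> \<rat>" "\<bar>lam\<bar> > lam0"
    have "C * \<bar>lam\<bar> powr (- (1 / (4 * (real n)\<^sup>2))) \<le> C * \<bar>lam\<bar> powr (- (2 / (2 * real (4 * n\<^sup>2) + 1)))"
      using exponent bounds \<open>\<bar>lam\<bar> > lam0\<close> by (intro mult_left_mono powr_mono) auto
    with asymp[rule_format, OF \<open>\<bar>lam\<bar> > lam0\<close>, of \<alpha> E]
    show "\<bar>lyapunov_exponent \<alpha> (schroedinger_matrix f lam E)
        - (ln \<bar>lam\<bar> + (LINT x:{0..1}|lborel. ln \<bar>E / lam - f x\<bar>))\<bar>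
      \<le> C * \<bar>lam\<bar> powr (- (2 / (2 * real (4 * n\<^sup>2) + 1)))"
      by (rule order_trans)
  qed
qed

end
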